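(* Let $\mathcal G$ be a finite nonempty collection of allowed words of $\Sigma_A$, all of length $2$, and let $\phi_P:\Sigma_A\to\mathbb R$ be $\phi_P(x)=\ln P_{x_1x_2}$. Then $$\rho(H_{\mathcal G})=\mathcal P_A(\phi_P)-\mathcal P_{B_{\mathcal G}}(\phi_P),$$ where $\mathcal P_A(\phi_P)$ is the topological pressure of $\phi_P$ on $(\Sigma_A,\sigma)$ and $\mathcal P_{B_{\mathcal G}}(\phi_P)$ is the topological pressure of the restriction of $\phi_P$ to $(\Sigma_{B_{\mathcal G}},\sigma)$ (with the convention that the pressure is $-\infty$ if $\Sigma_{B_{\mathcal G}}=\emptyset$, and $-\ln 0=+\infty$).
   Context: Let $\Sigma=\{1,\dots,N\}$, $A$ an irreducible $N\times N$ $0$–$1$ matrix, $\Sigma_A=\{x\in\Sigma^{\mathbb N}:A_{x_nx_{n+1}}=1\ \forall n\}$ with left shift $\sigma$; $\mathcal L_2$ is the set of allowed words of length $2$ (occurring in some element of $\Sigma_A$); $C_w$ is the set of $x\in\Sigma_A$ beginning with $w$. $P$ is a row-stochastic matrix with $P_{ij}>0$ iff $A_{ij}=1$, $\mathbf p$ its stationary vector, $\mu=\mu_P$ the Markov measure $\mu(C_w)=p_{w_1}P_{w_1w_2}\cdots P_{w_{n-1}w_n}$. $H_{\mathcal G}=\bigcup_{w\in\mathcal G}C_w$; $\mathcal W_m=\{x:\sigma^ix\notin H_{\mathcal G},0\le i\le m\}$, $\rho(H_{\mathcal G})=-\lim_m\frac1m\ln\mu(\mathcal W_m)$. Since all words in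 $\mathcal G$ have length 2, $B_{\mathcal G}$ is the $0$–$1$ matrix indexed by $\Sigma$ with $(B_{\mathcal G})_{ij}=1$ iff $ij\in\mathcal L_2$ and $ij\notin\mathcal G$; $\Sigma_{B_{\mathcal G}}=\{x\in\Sigma^{\mathbb N}:(B_{\mathcal G})_{x_nx_{n+1}}=1\ \forall n\}\subseteq\Sigma_A$. For a compact shift-invariant $Y\subseteq\Sigma_A$ and continuous $\phi$, the pressure is $\sup\{h_\nu(\sigma)+\int_Y\phi\,d\nu\}$ over $\sigma$-invariant Borel probability measures $\nu$ on $Y$, $h_\nu$ being measure-theoretic entropy. *)

theory Defs
  imports "HOL-Probability.Probability"
begin

text \<open>Alphabet is {1..N}; matrices are functions nat => nat => real, only
  entries with indices in {1..N} matter. Sequences x : nat => nat, indexed from 0.\<close>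

fun mat_pow :: "nat \<Rightarrow> (nat \<Rightarrow> nat \<Rightarrow> real) \<Rightarrow> nat \<Rightarrow> nat \<Rightarrow> nat \<Rightarrow> real" where
  "mat_pow N M 0 i j = (if i = j then 1 else 0)"
| "mat_pow N M (Suc n) i j = (\<Sum>k\<in>{1..N}. mat_pow N M n i k * M k j)"

definition zero_one_matrix :: "nat \<Rightarrow> (nat \<Rightarrow> nat \<Rightarrow> real) \<Rightarrow> bool" where
  "zero_one_matrix N M \<longleftrightarrow> (\<forall>i\<in>{1..N}. \<forall>j\<in>{1..N}. M i j = 0 \<or> M i j = 1)"

definition irreducible_matrix :: "nat \<Rightarrow> (nat \<Rightarrow> nat \<Rightarrow> real) \<Rightarrow> bool" where
  "irreducible_matrix N M \<longleftrightarrow>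
     (\<forall>i\<in>{1..N}. \<forall>j\<in>{1..N}. \<exists>n\<ge>1. mat_pow N M n i j > 0)"

definition row_stochastic :: "nat \<Rightarrow> (nat \<Rightarrow> nat \<Rightarrow> real) \<Rightarrow> bool" where
  "row_stochastic N P \<longleftrightarrow>
     (\<forall>i\<in>{1..N}. (\<forall>j\<in>{1..N}. P i j \<ge> 0) \<and> (\<Sum>j\<in>{1..N}. P i j) = 1)"

definition stationary_vector :: "nat \<Rightarrow> (nat \<Rightarrow> nat \<Rightarrow> real) \<Rightarrow> (nat \<Rightarrow> real) \<Rightarrow> bool" where
  "stationary_vector N P p \<longleftrightarrow>
     (\<forall>i\<in>{1..N}. p i \<ge> 0) \<and> (\<Sum>i\<in>{1..N}. p i) = 1 \<and>
     (\<forall>j\<in>{1..N}. (\<Sum>i\<in>{1..N}. p i * P i j) = p j)"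

definition shift_space :: "nat \<Rightarrow> (nat \<Rightarrow> nat \<Rightarrow> real) \<Rightarrow> (nat \<Rightarrow> nat) set" where
  "shift_space N M = {x. (\<forall>n. x n \<in> {1..N}) \<and> (\<forall>n. M (x n) (x (Suc n)) = 1)}"

definition shift :: "(nat \<Rightarrow> nat) \<Rightarrow> (nat \<Rightarrow> nat)" where
  "shift x = (\<lambda>n. x (Suc n))"

text \<open>Full shift space Sigma^N with its Borel (= product) sigma algebra.\<close>
definition full_shift_measure :: "nat \<Rightarrow> (nat \<Rightarrow> nat) measure" where
  "full_shift_measure N = PiM UNIV (\<lambda>_. count_space {1..N})"

definition allowed_word :: "nat \<Rightarrow> (nat \<Rightarrow> nat \<Rightarrow> real) \<Rightarrow> nat list \<Rightarrow> bool" where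
  "allowed_word N A w \<longleftrightarrow>
     (\<exists>x\<in>shift_space N A. \<exists>n. \<forall>i<length w. x (n + i) = w ! i)"

definition cylinder :: "nat \<Rightarrow> (nat \<Rightarrow> nat \<Rightarrow> real) \<Rightarrow> nat list \<Rightarrow> (nat \<Rightarrow> nat) set" where
  "cylinder N A w = {x\<in>shift_space N A. \<forall>i<length w. x i = w ! i}"

definition markov_measure :: "nat \<Rightarrow> (nat \<Rightarrow> nat \<Rightarrow> real) \<Rightarrow> (nat \<Rightarrow> nat \<Rightarrow> real)
     \<Rightarrow> (nat \<Rightarrow> real) \<Rightarrow> (nat \<Rightarrow> nat) measure \<Rightarrow> bool" where
  "markov_measure N A P p \<mu> \<longleftrightarrow>
     prob_space \<mu> \<and> sets \<mu> = sets (full_shift_measure N) \<and>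
     (\<forall>w. w \<noteq> [] \<and> set w \<subseteq> {1..N} \<longrightarrow>
        emeasure \<mu> (cylinder N A w) =
          ennreal (p (w ! 0) * (\<Prod>i<length w - 1. P (w ! i) (w ! Suc i))))"

definition hole :: "nat \<Rightarrow> (nat \<Rightarrow> nat \<Rightarrow> real) \<Rightarrow> nat list set \<Rightarrow> (nat \<Rightarrow> nat) set" where
  "hole N A G = (\<Union>w\<in>G. cylinder N A w)"

definition survivor :: "nat \<Rightarrow> (nat \<Rightarrow> nat \<Rightarrow> real) \<Rightarrow> nat list set \<Rightarrow> nat \<Rightarrow> (nat \<Rightarrow> nat) set" where
  "survivor N A G m = {x\<in>shift_space N A. \<forall>i\<le>m. (shift ^^ i) x \<notin> hole N A G}"

definition hole_matrix :: "nat \<Rightarrow> (nat \<Rightarrow> nat \<Rightarrow> real) \<Rightarrow> nat list set \<Rightarrow> nat \<Rightarrow> nat \<Rightarrow> real" where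
  "hole_matrix N A G i j = (if allowed_word N A [i, j] \<and> [i, j] \<notin> G then 1 else 0)"

definition partition_entropy :: "'a measure \<Rightarrow> 'a set set \<Rightarrow> real" where
  "partition_entropy \<nu> Q = (\<Sum>S\<in>Q. - measure \<nu> S * ln (measure \<nu> S))"

definition iterated_join :: "'a measure \<Rightarrow> ('a \<Rightarrow> 'a) \<Rightarrow> 'a set set \<Rightarrow> nat \<Rightarrow> 'a set set" where
  "iterated_join \<nu> T Q n =
     {space \<nu> \<inter> (\<Inter>i<n. (T ^^ i) -` f i) | f. \<forall>i<n. f i \<in> Q}"

definition finite_measurable_partitions :: "'a measure \<Rightarrow> 'a set set set" where
  "finite_measurable_partitions \<nu> =
     {Q. finite Q \<and> Q \<subseteq> sets \<nu> \<and> disjoint Q \<and> \<Union>Q = space \<nu>}"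

definition ks_entropy :: "'a measure \<Rightarrow> ('a \<Rightarrow> 'a) \<Rightarrow> ereal" where
  "ks_entropy \<nu> T = (SUP Q\<in>finite_measurable_partitions \<nu>.
       ereal (lim (\<lambda>n. partition_entropy \<nu> (iterated_join \<nu> T Q n) / real n)))"

text \<open>Shift-invariant Borel probability measures on a (compact shift-invariant) Y,
  represented as Borel probability measures on Sigma^N concentrated on Y.\<close>
definition invariant_measures_on :: "nat \<Rightarrow> (nat \<Rightarrow> nat) set \<Rightarrow> (nat \<Rightarrow> nat) measure set" where
  "invariant_measures_on N Y =
     {\<nu>. prob_space \<nu> \<and> sets \<nu> = sets (full_shift_measure N) \<and> emeasure \<nu> Y = 1 \<and>
          shift \<in> measurable \<nu> \<nu> \<and> distr \<nu> \<nu> shift = \<nu>}"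

text \<open>Topological pressure via the variational formula; -\<infinity> if there is no measure.\<close>
definition pressure :: "nat \<Rightarrow> (nat \<Rightarrow> nat) set \<Rightarrow> ((nat \<Rightarrow> nat) \<Rightarrow> real) \<Rightarrow> ereal" where
  "pressure N Y \<phi> = (SUP \<nu>\<in>invariant_measures_on N Y.
       ks_entropy \<nu> shift + ereal (\<integral>x. \<phi> x \<partial>\<nu>))"

definition escape_seq :: "(nat \<Rightarrow> nat) measure \<Rightarrow> ((nat \<Rightarrow> nat) set) \<Rightarrow> ereal" where
  "escape_seq \<mu> W = (if measure \<mu> W = 0 then \<infinity> else ereal (- ln (measure \<mu> W)))"

end

theory Submission
  imports Defs "HOL-Real_Asymp.Real_Asymp"
begin

text \<open>
  For a nonnegative matrix \<open>W\<close> supported on the edges of a transition matrix \<open>B\<close> let \<open>Z\<^sub>n\<close> be the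
  total \<open>W\<close>-weight of all words with \<open>n\<close> edges, and put \<open>\<phi>(x) = ln W(x\<^sub>0, x\<^sub>1)\<close>. Taking for \<open>W\<close> the
  matrix \<open>P\<close> with the edges in the hole deleted, the measure of the survivor set is \<open>Z\<^sub>m\<^sub>+\<^sub>1\<close> up to a
  factor bounded away from \<open>0\<close> and \<open>\<infinity>\<close>, so the theorem amounts to the variational principle: the
  pressure of \<open>\<phi>\<close> on \<open>\<Sigma>\<^sub>B\<close> is \<open>lim (ln Z\<^sub>n) / n\<close>. (For \<open>W = P\<close> and \<open>B = A\<close> one has \<open>Z\<^sub>n = N\<close> and
  pressure \<open>0\<close>.) Both inequalities come from Gibbs' inequality \<open>\<Sum> p ln q \<le> \<Sum> p ln p\<close>.

  Upper bound: a finite measurable partition is determined by the first \<open>k\<close> letters outside a set of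
  small measure. Comparing the joint law of itinerary and letters with the law that draws letters
  proportionally to their weight and then guesses the itinerary from windows of \<open>k\<close> letters bounds
  the entropy of the itinerary by \<open>ln Z\<^sub>n - n \<integral>\<phi> + n \<epsilon>\<close> up to a constant.

  Lower bound: let \<open>q\<^sub>n\<close> be the average law of an edge of a random word of length \<open>n + 1\<close> drawn
  proportionally to its weight. Comparing with the Markov chain that has edge law \<open>q\<^sub>n\<close> gives
  \<open>ln Z\<^sub>n \<le> ln N + n F(q\<^sub>n)\<close>, where \<open>F(q)\<close> is the entropy plus the integral of \<open>\<phi>\<close> for that chain.
  A limit point \<open>q\<close> of \<open>q\<^sub>n\<close> is stationary, and the Markov measure with edge law \<open>q\<close> is an invariant
  measure on \<open>\<Sigma>\<^sub>B\<close>.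
\<close>

section \<open>Words, Gibbs' inequality and subadditive sequences\<close>

definition words :: "'a set \<Rightarrow> nat \<Rightarrow> 'a list set" where
  "words S n = {w. set w \<subseteq> S \<and> length w = n}"

lemma finite_words [simp]: "finite S \<Longrightarrow> finite (words S n)"
  unfolding words_def by (rule finite_lists_length_eq)

lemma words_0 [simp]: "words S 0 = {[]}"
  by (auto simp: words_def)

lemma length_words: "w \<in> words S n \<Longrightarrow> length w = n"
  by (simp add: words_def)

lemma nth_words: "w \<in> words S n \<Longrightarrow> i < n \<Longrightarrow> w ! i \<in> S"
  unfolding words_def using nth_mem by blast

lemma map_upt_in_words: "(\<And>i. i < n \<Longrightarrow> f i \<in> S) \<Longrightarrow> map f [0..<n] \<in> words S n"
  by (auto simp: words_def)

lemma sum_words_append: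
  "(\<Sum>w\<in>words S (m + n). f w) = (\<Sum>u\<in>words S m. \<Sum>v\<in>words S n. f (u @ v))"
proof -
  have "(\<Sum>w\<in>words S (m + n). f w) = (\<Sum>(u, v)\<in>words S m \<times> words S n. f (u @ v))"
    by (rule sum.reindex_bij_witness[where i = "\<lambda>(u, v). u @ v" and j = "\<lambda>w. (take m w, drop m w)"])
      (auto simp: words_def dest: in_set_takeD in_set_dropD)
  then show ?thesis
    by (simp add: sum.cartesian_product)
qed

lemma sum_words_1: "(\<Sum>w\<in>words S (Suc 0). f w) = (\<Sum>a\<in>S. f [a])"
  by (rule sum.reindex_bij_witness[where i = "\<lambda>a. [a]" and j = hd])
    (auto simp: words_def length_Suc_conv)

lemma sum_words_Suc:
  "(\<Sum>w\<in>words S (Suc n). f w) = (\<Sum>w\<in>words S n. \<Sum>a\<in>S. f (w @ [a]))"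
  using sum_words_append[of f S n "Suc 0"] by (simp add: sum_words_1)

lemma sum_words_prod:
  fixes f :: "nat \<Rightarrow> 'a \<Rightarrow> 'b::comm_semiring_1"
  shows "(\<Sum>w\<in>words S n. \<Prod>i<n. f i (w ! i)) = (\<Prod>i<n. \<Sum>a\<in>S. f i a)"
proof (induction n)
  case (Suc n)
  have "(\<Sum>w\<in>words S (Suc n). \<Prod>i<Suc n. f i (w ! i))
      = (\<Sum>w\<in>words S n. \<Sum>a\<in>S. (\<Prod>i<n. f i (w ! i)) * f n a)"
    unfolding sum_words_Suc by (intro sum.cong refl) (simp add: nth_append length_words)
  also have "\<dots> = (\<Sum>w\<in>words S n. \<Prod>i<n. f i (w ! i)) * (\<Sum>a\<in>S. f n a)"
    by (simp add: sum_product)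
  finally show ?case
    using Suc by simp
qed simp

lemma gibbs_inequality:
  fixes p q :: "'a \<Rightarrow> real"
  assumes "\<And>i. i \<in> I \<Longrightarrow> 0 \<le> p i" and "\<And>i. i \<in> I \<Longrightarrow> 0 \<le> q i"
    and "\<And>i. i \<in> I \<Longrightarrow> 0 < p i \<Longrightarrow> 0 < q i" and "sum q I \<le> sum p I"
  shows "(\<Sum>i\<in>I. p i * ln (q i)) \<le> (\<Sum>i\<in>I. p i * ln (p i))"
proof -
  have "p i * ln (q i) - p i * ln (p i) \<le> q i - p i" if "i \<in> I" for i
  proof (cases "p i = 0")
    case True
    then show ?thesis using assms(2)[OF that] by simp
  next
    case False
    then have pos: "0 < p i" "0 < q i"
      using assms(1,3)[OF that] by auto
    then have "p i * ln (q i / p i) \<le> p i * (q i / p i - 1)"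
      by (intro mult_left_mono ln_le_minus_one) auto
    then show ?thesis
      using pos by (simp add: ln_div algebra_simps)
  qed
  then have "(\<Sum>i\<in>I. p i * ln (q i) - p i * ln (p i)) \<le> (\<Sum>i\<in>I. q i - p i)"
    by (rule sum_mono)
  then show ?thesis
    using assms(4) by (simp add: sum_subtractf)
qed

lemma subadditive_mult_add_le:
  fixes u :: "nat \<Rightarrow> real"
  assumes "\<And>m n. u (m + n) \<le> u m + u n"
  shows "u (q * k + r) \<le> real q * u k + u r"
proof (induction q)
  case (Suc q)
  have "u (k + (q * k + r)) \<le> u k + (real q * u k + u r)"
    using assms[of k "q * k + r"] Suc by simp
  then show ?case by (simp add: algebra_simps)
qed simp

lemma subadditive_quotient_le:
  fixes u :: "nat \<Rightarrow> real"
  assumes sub: "\<And>m n. u (m + n) \<le> u m + u n" and k: "0 < k" and n: "0 < n"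
  shows "u n / real n \<le> u k / real k + (\<Sum>r\<le>k. \<bar>u r\<bar>) / real n"
proof -
  define q r where "q = n div k" and "r = n mod k"
  have r: "r < k" and n_eq: "real n = real q * real k + real r"
    using k by (simp_all add: q_def r_def flip: of_nat_mult of_nat_add)
  have "real r / real k * \<bar>u k\<bar> \<le> 1 * \<bar>u k\<bar>"
    using r by (intro mult_right_mono) auto
  then have "- (real r / real k * u k) \<le> \<bar>u k\<bar>"
    using abs_ge_minus_self[of "real r / real k * u k"] by (simp add: abs_mult)
  moreover have "real q * u k = real n * (u k / real k) - real r / real k * u k"
    using k by (simp add: n_eq field_simps)
  moreover have "\<bar>u r\<bar> + \<bar>u k\<bar> \<le> (\<Sum>r\<le>k. \<bar>u r\<bar>)"
    using r sum_mono2[of "{..k}" "{r, k}" "\<lambda>r. \<bar>u r\<bar>"] by auto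
  moreover have "u n \<le> real q * u k + u r"
    using subadditive_mult_add_le[OF sub, of q k r] by (simp add: q_def r_def)
  ultimately have "u n \<le> real n * (u k / real k) + (\<Sum>r\<le>k. \<bar>u r\<bar>)"
    using abs_ge_self[of "u r"] by linarith
  then show ?thesis
    using n by (simp add: field_simps)
qed

lemma fekete:
  fixes u :: "nat \<Rightarrow> real"
  assumes sub: "\<And>m n. u (m + n) \<le> u m + u n" and bdd: "bdd_below ((\<lambda>n. u n / real n) ` {1..})"
  shows "(\<lambda>n. u n / real n) \<longlonglongrightarrow> (INF n\<in>{1..}. u n / real n)"
proof (rule order_tendstoI)
  fix a assume "a < (INF n\<in>{1..}. u n / real n)"
  then have "a < u n / real n" if "1 \<le> n" for n
    using cINF_lower[OF bdd, of n] that by auto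
  then show "\<forall>\<^sub>F n in sequentially. a < u n / real n"
    by (auto simp: eventually_sequentially)
next
  fix a assume "(INF n\<in>{1..}. u n / real n) < a"
  then obtain k where k: "0 < k" "u k / real k < a"
    using cINF_less_iff[OF _ bdd, of a] by (auto simp: Suc_le_eq)
  have "(\<lambda>n. u k / real k + (\<Sum>r\<le>k. \<bar>u r\<bar>) / real n) \<longlonglongrightarrow> u k / real k + 0"
    by (intro tendsto_intros lim_const_over_n)
  then have "\<forall>\<^sub>F n in sequentially. u k / real k + (\<Sum>r\<le>k. \<bar>u r\<bar>) / real n < a"
    using k by (intro order_tendstoD) auto
  then show "\<forall>\<^sub>F n in sequentially. u n / real n < a"
    using eventually_gt_at_top[of 0]
  proof eventually_elim
    case (elim n)
    then show ?case
      using subadditive_quotient_le[OF sub k(1), of n] by linarith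
  qed
qed

section \<open>Limits and approximation\<close>

lemma isCont_mult_ln: "isCont (\<lambda>x::real. x * ln x) a"
proof (cases "a = 0")
  case True
  have "((\<lambda>x::real. x * ln x) \<longlongrightarrow> 0) (at_right 0)"
    by real_asymp
  moreover from tendsto_minus[OF this] have "((\<lambda>x::real. x * ln x) \<longlongrightarrow> 0) (at_left 0)"
    unfolding at_left_minus[of 0] filterlim_filtermap by (simp add: ln_minus)
  ultimately show ?thesis
    using True by (simp add: isCont_def filterlim_split_at)
qed (auto intro!: continuous_intros)

lemma finite_family_convergent_subseq:
  fixes f :: "nat \<Rightarrow> 'a \<Rightarrow> 'b::metric_space"
  assumes "finite S" and "compact C" and f: "\<And>n s. s \<in> S \<Longrightarrow> f n s \<in> C"
  shows "\<exists>l r. strict_mono (r::nat \<Rightarrow> nat) \<and> (\<forall>s\<in>S. (\<lambda>n. f (r n) s) \<longlonglongrightarrow> l s)"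
  using assms(1) f
proof (induction rule: finite_induct)
  case empty
  show ?case
    using strict_mono_id by blast
next
  case (insert s S)
  then obtain l and r :: "nat \<Rightarrow> nat" where r: "strict_mono r" "\<forall>s\<in>S. (\<lambda>n. f (r n) s) \<longlonglongrightarrow> l s"
    by auto
  obtain l' and r' :: "nat \<Rightarrow> nat" where r': "strict_mono r'" "((\<lambda>n. f (r n) s) \<circ> r') \<longlonglongrightarrow> l'"
    using \<open>compact C\<close> insert.prems unfolding compact_eq_seq_compact_metric seq_compact_def
    by (metis insertI1)
  have "(\<lambda>n. f ((r \<circ> r') n) t) \<longlonglongrightarrow> (l(s := l')) t" if "t \<in> insert s S" for t
  proof (cases "t = s")
    case True
    then show ?thesis
      using r'(2) by (simp add: comp_def)
  next
    case False
    then show ?thesis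
      using that r(2) LIMSEQ_subseq_LIMSEQ[OF _ r'(1)] by (fastforce simp: comp_def)
  qed
  then show ?case
    using strict_mono_o[OF r(1) r'(1)] by blast
qed

lemma (in finite_measure) measure_UN_atMost_approx:
  fixes a :: "nat \<Rightarrow> 'a set"
  assumes a: "range a \<subseteq> sets M" and e: "0 < e"
  shows "\<exists>n. measure M ((\<Union>i. a i) - (\<Union>i\<le>n. a i)) < e"
proof -
  have "(\<lambda>n. measure M (\<Union>i\<le>n. a i)) \<longlonglongrightarrow> measure M (\<Union>n. \<Union>i\<le>n. a i)"
    using a by (intro finite_Lim_measure_incseq monoI UN_mono) auto
  also have "(\<Union>n. \<Union>i\<le>n. a i) = (\<Union>i. a i)"
    by auto
  finally have "\<forall>\<^sub>F n in sequentially. measure M (\<Union>i. a i) - e < measure M (\<Union>i\<le>n. a i)"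
    using e by (intro order_tendstoD) auto
  then obtain n where "measure M (\<Union>i. a i) - e < measure M (\<Union>i\<le>n. a i)"
    by (auto simp: eventually_sequentially)
  moreover have "measure M ((\<Union>i. a i) - (\<Union>i\<le>n. a i)) = measure M (\<Union>i. a i) - measure M (\<Union>i\<le>n. a i)"
    using a by (intro finite_measure_Diff) auto
  ultimately show ?thesis
    by (intro exI[of _ n]) simp
qed

lemma (in finite_measure) measure_sym_diff_UN_le:
  assumes "finite J" and "\<And>i. i \<in> J \<Longrightarrow> a i \<in> sets M" and "\<And>i. i \<in> J \<Longrightarrow> b i \<in> sets M"
    and "E \<in> sets M" and "(\<Union>i\<in>J. a i) \<subseteq> E"
  shows "measure M (sym_diff E (\<Union>i\<in>J. b i))
    \<le> measure M (E - (\<Union>i\<in>J. a i)) + (\<Sum>i\<in>J. measure M (sym_diff (a i) (b i)))"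
proof -
  have sets: "(\<Union>i\<in>J. sym_diff (a i) (b i)) \<in> sets M" "E - (\<Union>i\<in>J. a i) \<in> sets M"
    using assms by (auto intro!: sets.Un sets.Diff sets.finite_UN)
  have "measure M (sym_diff E (\<Union>i\<in>J. b i))
      \<le> measure M ((E - (\<Union>i\<in>J. a i)) \<union> (\<Union>i\<in>J. sym_diff (a i) (b i)))"
    using assms(5) sets by (intro finite_measure_mono sets.Un) auto
  also have "\<dots> \<le> measure M (E - (\<Union>i\<in>J. a i)) + measure M (\<Union>i\<in>J. sym_diff (a i) (b i))"
    using sets by (intro measure_Un_le) auto
  also have "measure M (\<Union>i\<in>J. sym_diff (a i) (b i)) \<le> (\<Sum>i\<in>J. measure M (sym_diff (a i) (b i)))"
    using assms by (intro measure_UNION_le sets.Un sets.Diff) auto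
  finally show ?thesis
    by simp
qed

lemma (in finite_measure) approximation_UN:
  fixes a :: "nat \<Rightarrow> 'a set"
  assumes a: "range a \<subseteq> sets M" and \<A>: "\<A> \<subseteq> sets M" and e: "0 < e"
    and finite_UN: "\<And>n A. (\<And>i. A i \<in> \<A>) \<Longrightarrow> (\<Union>i\<le>n::nat. A i) \<in> \<A>"
    and approx: "\<And>i e. 0 < e \<Longrightarrow> \<exists>A\<in>\<A>. measure M (sym_diff (a i) A) < e"
  shows "\<exists>A\<in>\<A>. measure M (sym_diff (\<Union>i. a i) A) < e"
proof -
  obtain n where n: "measure M ((\<Union>i. a i) - (\<Union>i\<le>n. a i)) < e / 2"
    using measure_UN_atMost_approx[OF a, of "e / 2"] e by auto
  have "\<exists>A\<in>\<A>. measure M (sym_diff (a i) A) < e / (2 * real (Suc n))" for i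
    using approx e by simp
  then obtain A where A: "A i \<in> \<A>" "measure M (sym_diff (a i) (A i)) < e / (2 * real (Suc n))" for i
    by metis
  have "measure M (sym_diff (\<Union>i. a i) (\<Union>i\<le>n. A i))
      \<le> measure M ((\<Union>i. a i) - (\<Union>i\<le>n. a i)) + (\<Sum>i\<le>n. measure M (sym_diff (a i) (A i)))"
    using a \<A> A(1) by (intro measure_sym_diff_UN_le) auto
  also have "\<dots> < e / 2 + (\<Sum>i\<le>n. e / (2 * real (Suc n)))"
    using n A(2) by (intro add_less_le_mono sum_mono less_imp_le) auto
  also have "\<dots> = e"
    by (simp add: field_simps)
  finally show ?thesis
    using finite_UN[of A n] A(1) by blast
qed

lemma (in finite_measure) algebra_approximation:
  assumes alg: "algebra (space M) \<A>" and gen: "sets M = sigma_sets (space M) \<A>"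
    and E: "E \<in> sets M" and e: "0 < e"
  shows "\<exists>A\<in>\<A>. measure M (sym_diff E A) < e"
proof -
  interpret algebra "space M" \<A> by fact
  have sub: "\<A> \<subseteq> sets M"
    using gen by auto
  from E e show ?thesis
    unfolding gen
  proof (induction arbitrary: e)
    case (Basic A)
    then show ?case
      by (intro bexI[of _ A]) auto
  next
    case Empty
    then show ?case
      by (intro bexI[of _ "{}"]) auto
  next
    case (Compl E)
    then obtain A where A: "A \<in> \<A>" "measure M (sym_diff E A) < e"
      by blast
    have "sym_diff (space M - E) (space M - A) = sym_diff E A"
      using sets.sets_into_space Compl.hyps gen sub A(1) by blast
    with A show ?case
      by (intro bexI[of _ "space M - A"]) auto
  next
    case (Union a)
    show ?case
      using Union.hyps gen by (intro approximation_UN sub Union.prems Union.IH finite_UN) auto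
  qed
qed

section \<open>Entropy of simple functions\<close>

abbreviation point_mass :: "'a measure \<Rightarrow> ('a \<Rightarrow> 'b) \<Rightarrow> 'b \<Rightarrow> real" where
  "point_mass M X a \<equiv> measure M (X -` {a} \<inter> space M)"

lemma simple_function_map_upt:
  assumes "\<And>i. simple_function M (f i)"
  shows "simple_function M (\<lambda>x. map (\<lambda>i. f i x) [0..<n])"
proof (induction n)
  case (Suc n)
  from simple_function_compose2[OF this assms, of "\<lambda>w a. w @ [a]"] show ?case
    by simp
qed simp

context prob_space
begin

abbreviation shannon_entropy :: "('a \<Rightarrow> 'b) \<Rightarrow> real" where
  "shannon_entropy X \<equiv> entropy (exp 1) (count_space (X ` space M)) X"

lemma integrable_simple_function:
  fixes f :: "'a \<Rightarrow> real"
  assumes "simple_function M f"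
  shows "integrable M f"
  using has_bochner_integral_simple_bochner_integrable[OF simple_bochner_integrable.intros[OF assms]]
  by (auto simp: has_bochner_integral_iff)

lemma distributed_point_mass:
  assumes "simple_function M X" and "finite I" and "X \<in> space M \<rightarrow> I"
  shows "distributed M (count_space I) X (\<lambda>a. ennreal (point_mass M X a))"
proof -
  have "(if a \<in> X ` space M then point_mass M X a else 0) = point_mass M X a" for a
  proof -
    have "X -` {a} \<inter> space M = {}" if "a \<notin> X ` space M"
      using that by auto
    then show ?thesis
      by simp
  qed
  then show ?thesis
    using distributed_simple_function_superset[OF assms(1), of "point_mass M X" I] assms(2,3)
    by (simp only: image_subset_iff_funcset)
qed

lemma integral_simple_function:
  fixes g :: "'b \<Rightarrow> real"
  assumes "simple_function M X" and "finite I" and "X \<in> space M \<rightarrow> I"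
  shows "(\<integral>x. g (X x) \<partial>M) = (\<Sum>a\<in>I. point_mass M X a * g a)"
  using distributed_integral[OF distributed_point_mass[OF assms], of g] assms(2)
  by (simp add: lebesgue_integral_count_space_finite)

lemma sum_point_mass:
  assumes "simple_function M X" and "finite I" and "X \<in> space M \<rightarrow> I"
  shows "(\<Sum>a\<in>I. point_mass M X a) = 1"
  using integral_simple_function[OF assms, of "\<lambda>_. 1"] by (simp add: prob_space)

lemma shannon_entropy_eq_sum:
  assumes "simple_function M X" and "finite I" and "X \<in> space M \<rightarrow> I"
  shows "shannon_entropy X = (\<Sum>a\<in>I. - point_mass M X a * ln (point_mass M X a))"
proof -
  interpret information_space M "exp 1"
    by unfold_locales simp
  have "simple_distributed M X (point_mass M X)"
    by (rule simple_distributedI) (use assms in auto)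
  then have "shannon_entropy X = (\<Sum>a\<in>X ` space M. - point_mass M X a * ln (point_mass M X a))"
    by (simp add: entropy_simple_distributed sum_negf log_ln)
  also have "\<dots> = (\<Sum>a\<in>I. - point_mass M X a * ln (point_mass M X a))"
  proof (rule sum.mono_neutral_left)
    have "X -` {a} \<inter> space M = {}" if "a \<notin> X ` space M" for a
      using that by auto
    then show "\<forall>a\<in>I - X ` space M. - point_mass M X a * ln (point_mass M X a) = 0"
      by simp
  qed (use assms in auto)
  finally show ?thesis .
qed

lemma shannon_entropy_cong:
  assumes X: "simple_function M X" and eq: "\<And>x. x \<in> space M \<Longrightarrow> X x = Y x"
  shows "shannon_entropy X = shannon_entropy Y"
proof -
  have "point_mass M X a = point_mass M Y a" for a
    using eq by (intro arg_cong[where f = prob]) auto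
  moreover have "simple_function M Y"
    using X eq simple_function_cong[of M X Y] by simp
  ultimately show ?thesis
    using shannon_entropy_eq_sum[OF X simple_functionD(1)[OF X]] eq
      shannon_entropy_eq_sum[of Y "X ` space M"] simple_functionD(1)[OF X] by force
qed

lemma shannon_entropy_nonneg:
  assumes "simple_function M X"
  shows "0 \<le> shannon_entropy X"
proof -
  have "p * ln p \<le> 0" if "0 \<le> p" "p \<le> 1" for p :: real
    using that by (cases "p = 0") (auto simp: mult_le_0_iff)
  then show ?thesis
    by (subst shannon_entropy_eq_sum[OF assms simple_functionD(1)[OF assms]])
      (auto intro!: sum_nonneg)
qed

lemma shannon_entropy_Pair_ge:
  assumes "simple_function M X" and "simple_function M Y"
  shows "shannon_entropy X \<le> shannon_entropy (\<lambda>x. (X x, Y x))"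
proof -
  interpret information_space M "exp 1"
    by unfold_locales simp
  show ?thesis
    using entropy_data_processing[OF simple_function_Pair[OF assms], of fst] by (simp add: comp_def)
qed

lemma shannon_entropy_compose_Pair_le:
  assumes "simple_function M X" and "simple_function M Y"
  shows "shannon_entropy (\<lambda>x. h (X x) (Y x)) \<le> shannon_entropy X + shannon_entropy Y"
proof -
  interpret information_space M "exp 1"
    by unfold_locales simp
  have "shannon_entropy (\<lambda>x. h (X x) (Y x)) \<le> shannon_entropy (\<lambda>x. (X x, Y x))"
    using entropy_data_processing[OF simple_function_Pair[OF assms], of "case_prod h"]
    by (simp add: comp_def)
  also have "\<dots> \<le> shannon_entropy X + shannon_entropy Y"
    using entropy_chain_rule[OF assms] conditional_entropy_less_eq_entropy[OF assms(2,1)] by simp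
  finally show ?thesis .
qed

lemma shannon_entropy_le_integral:
  fixes R :: "'b \<Rightarrow> real"
  assumes X: "simple_function M X" and I: "finite I" "X \<in> space M \<rightarrow> I"
    and R: "\<And>a. a \<in> I \<Longrightarrow> 0 \<le> R a" "sum R I \<le> 1" and pos: "AE x in M. 0 < R (X x)"
  shows "shannon_entropy X \<le> (\<integral>x. - ln (R (X x)) \<partial>M)"
proof -
  have "0 < R a" if a: "0 < point_mass M X a" for a
  proof (rule ccontr)
    assume "\<not> 0 < R a"
    with pos have "AE x in M. x \<notin> X -` {a} \<inter> space M"
      by (auto elim!: eventually_mono)
    then have "point_mass M X a = 0"
      using simple_functionD(2)[OF X] by (subst prob_eq_0) auto
    with a show False by simp
  qed
  then have "(\<Sum>a\<in>I. point_mass M X a * ln (R a)) \<le> (\<Sum>a\<in>I. point_mass M X a * ln (point_mass M X a))"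
    using R sum_point_mass[OF X I] by (intro gibbs_inequality) auto
  then show ?thesis
    using integral_simple_function[OF X I, of "\<lambda>a. - ln (R a)"] shannon_entropy_eq_sum[OF X I]
    by (simp add: sum_negf del: Bochner_Integration.integral_minus)
qed

end

section \<open>Entropy of a partition along a measure-preserving map\<close>

locale measure_preserving = prob_space M for M :: "'a measure" and T :: "'a \<Rightarrow> 'a" +
  assumes measurable_T: "T \<in> measurable M M" and distr_T: "distr M M T = M"
begin

lemma measurable_iterate: "T ^^ i \<in> measurable M M"
  by (rule measurable_compose_n[OF measurable_T])

lemma distr_iterate: "distr M M (T ^^ i) = M"
proof (induction i)
  case 0
  then show ?case by (simp add: id_def distr_id)
next
  case (Suc i)
  then show ?case
    using distr_distr[OF measurable_T measurable_iterate[of i]] distr_T by (simp add: comp_def)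
qed

lemma AE_iterate:
  assumes "AE x in M. P x"
  shows "AE x in M. P ((T ^^ i) x)"
  using AE_distrD[OF measurable_iterate[of i], of P] assms by (simp only: distr_iterate)

lemma integrable_iterate:
  fixes f :: "'a \<Rightarrow> real"
  assumes "integrable M f"
  shows "integrable M (\<lambda>x. f ((T ^^ i) x))"
  using assms distr_iterate[of i] by (metis integrable_distr measurable_iterate)

lemma integrable_birkhoff_sum:
  fixes f :: "'a \<Rightarrow> real"
  assumes "integrable M f"
  shows "integrable M (\<lambda>x. \<Sum>i<n. f ((T ^^ i) x))"
  by (intro Bochner_Integration.integrable_sum integrable_iterate assms)

lemma integral_birkhoff_sum:
  fixes f :: "'a \<Rightarrow> real"
  assumes f: "integrable M f"
  shows "(\<integral>x. (\<Sum>i<n. f ((T ^^ i) x)) \<partial>M) = real n * (\<integral>x. f x \<partial>M)"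
proof -
  have "(\<integral>x. f ((T ^^ i) x) \<partial>M) = (\<integral>x. f x \<partial>M)" for i
    using integral_distr[OF measurable_iterate borel_measurable_integrable[OF f], of i]
    by (simp add: distr_iterate)
  then show ?thesis
    using integrable_iterate[OF f] by simp
qed

lemma simple_function_iterate:
  "simple_function M X \<Longrightarrow> simple_function M (\<lambda>x. X ((T ^^ i) x))"
  using simple_function_comp[OF measurable_iterate, of X i] by (simp add: comp_def)

lemma shannon_entropy_iterate:
  assumes X: "simple_function M X"
  shows "shannon_entropy (\<lambda>x. X ((T ^^ i) x)) = shannon_entropy X"
proof -
  have "point_mass M (\<lambda>x. X ((T ^^ i) x)) a = point_mass M X a" for a
  proof -
    have "point_mass M X a = prob ((T ^^ i) -` (X -` {a} \<inter> space M) \<inter> space M)"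
      using measure_distr[OF measurable_iterate simple_functionD(2)[OF X]] by (metis distr_iterate)
    also have "(T ^^ i) -` (X -` {a} \<inter> space M) \<inter> space M = (\<lambda>x. X ((T ^^ i) x)) -` {a} \<inter> space M"
      using measurable_space[OF measurable_iterate] by auto
    finally show ?thesis by simp
  qed
  moreover have "(\<lambda>x. X ((T ^^ i) x)) \<in> space M \<rightarrow> X ` space M"
    using measurable_space[OF measurable_iterate] by auto
  ultimately show ?thesis
    using simple_functionD(1)[OF X]
      shannon_entropy_eq_sum[OF simple_function_iterate[OF X], of "X ` space M"]
      shannon_entropy_eq_sum[OF X, of "X ` space M"] by auto
qed

end

definition cell :: "'a set set \<Rightarrow> 'a \<Rightarrow> 'a set" where
  "cell Q x = (THE S. S \<in> Q \<and> x \<in> S)"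

definition itinerary :: "('a \<Rightarrow> 'a) \<Rightarrow> 'a set set \<Rightarrow> nat \<Rightarrow> 'a \<Rightarrow> 'a set list" where
  "itinerary T Q n x = map (\<lambda>i. cell Q ((T ^^ i) x)) [0..<n]"

lemma itinerary_add: "itinerary T Q (m + n) x = itinerary T Q m x @ itinerary T Q n ((T ^^ m) x)"
proof -
  have "[0..<m + n] = [0..<m] @ map (\<lambda>i. i + m) [0..<n]"
    by (simp only: map_add_upt upt_add_eq_append[of 0 m n] add.commute)
  then show ?thesis
    by (simp add: itinerary_def funpow_add comp_def)
qed

locale finite_partition =
  fixes M :: "'a measure" and Q :: "'a set set"
  assumes partition: "Q \<in> finite_measurable_partitions M"
begin

lemma finite_Q: "finite Q" and sets_Q: "S \<in> Q \<Longrightarrow> S \<in> sets M" and Union_Q: "\<Union>Q = space M"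
  and disjoint_Q: "disjoint Q"
  using partition by (auto simp: finite_measurable_partitions_def)

lemma cell_eqI: "S \<in> Q \<Longrightarrow> x \<in> S \<Longrightarrow> cell Q x = S"
  unfolding cell_def using disjoint_Q by (intro the_equality) (auto simp: disjoint_def)

lemma
  assumes "x \<in> space M"
  shows cell_in_Q: "cell Q x \<in> Q" and in_cell: "x \<in> cell Q x"
proof -
  obtain S where "S \<in> Q" "x \<in> S"
    using assms Union_Q by auto
  then show "cell Q x \<in> Q" "x \<in> cell Q x"
    by (simp_all add: cell_eqI)
qed

lemma cell_eq_iff: "x \<in> space M \<Longrightarrow> S \<in> Q \<Longrightarrow> cell Q x = S \<longleftrightarrow> x \<in> S"
  using in_cell[of x] cell_eqI[of S x] by blast

lemma simple_function_cell: "simple_function M (cell Q)"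
  unfolding simple_function_def
proof (intro conjI ballI)
  show "finite (cell Q ` space M)"
    using cell_in_Q by (intro finite_subset[OF _ finite_Q]) auto
next
  fix S assume "S \<in> cell Q ` space M"
  then have S: "S \<in> Q"
    using cell_in_Q by auto
  then have "S \<subseteq> space M"
    using Union_Q by blast
  then have "cell Q -` {S} \<inter> space M = S"
    using cell_eq_iff[OF _ S] by blast
  then show "cell Q -` {S} \<inter> space M \<in> sets M"
    using sets_Q[OF S] by simp
qed

end

locale preserved_partition = measure_preserving M T + finite_partition M Q
  for M :: "'a measure" and T Q
begin

lemma simple_function_itinerary: "simple_function M (itinerary T Q n)"
  unfolding itinerary_def
  by (intro simple_function_map_upt simple_function_iterate simple_function_cell)

lemma itinerary_in_words: "itinerary T Q n \<in> space M \<rightarrow> words Q n"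
  unfolding itinerary_def
  by (intro funcsetI map_upt_in_words cell_in_Q measurable_space[OF measurable_iterate])

lemma itinerary_fibre:
  assumes w: "w \<in> words Q n"
  shows "itinerary T Q n -` {w} \<inter> space M = space M \<inter> (\<Inter>i<n. (T ^^ i) -` (w ! i))"
proof -
  have "itinerary T Q n x = w \<longleftrightarrow> (\<forall>i<n. (T ^^ i) x \<in> w ! i)" if "x \<in> space M" for x
    using w nth_words[OF w] cell_eq_iff[OF measurable_space[OF measurable_iterate that]]
    by (auto simp: list_eq_iff_nth_eq itinerary_def length_words)
  then show ?thesis
    by auto
qed

lemma iterated_join_eq: "iterated_join M T Q n = (\<lambda>w. itinerary T Q n -` {w} \<inter> space M) ` words Q n"
proof (safe, goal_cases)
  case (1 S)
  then obtain f where f: "S = space M \<inter> (\<Inter>i<n. (T ^^ i) -` f i)" "\<forall>i<n. f i \<in> Q"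
    by (auto simp: iterated_join_def)
  then have w: "map f [0..<n] \<in> words Q n"
    by (intro map_upt_in_words) auto
  then show ?case
    using f by (auto simp: itinerary_fibre intro!: image_eqI[OF _ w])
next
  case (2 S w)
  then show ?case
    by (auto simp: itinerary_fibre iterated_join_def nth_words intro!: exI[of _ "\<lambda>i. w ! i"])
qed

lemma partition_entropy_iterated_join:
  "partition_entropy M (iterated_join M T Q n) = shannon_entropy (itinerary T Q n)"
proof -
  have "partition_entropy M (iterated_join M T Q n)
      = (\<Sum>w\<in>words Q n. - point_mass M (itinerary T Q n) w * ln (point_mass M (itinerary T Q n) w))"
    unfolding partition_entropy_def iterated_join_eq
  proof (subst sum.reindex_nontrivial)
    fix u v assume "u \<noteq> v" "itinerary T Q n -` {u} \<inter> space M = itinerary T Q n -` {v} \<inter> space M"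
    then have "itinerary T Q n -` {u} \<inter> space M = {}"
      by auto
    then show "- point_mass M (itinerary T Q n) u * ln (point_mass M (itinerary T Q n) u) = 0"
      by simp
  qed (simp_all add: finite_Q)
  also have "\<dots> = shannon_entropy (itinerary T Q n)"
    by (intro shannon_entropy_eq_sum[symmetric] simple_function_itinerary itinerary_in_words)
      (simp add: finite_Q)
  finally show ?thesis .
qed

lemma shannon_entropy_itinerary_subadditive:
  "shannon_entropy (itinerary T Q (m + n))
    \<le> shannon_entropy (itinerary T Q m) + shannon_entropy (itinerary T Q n)"
proof -
  have "shannon_entropy (itinerary T Q (m + n))
      \<le> shannon_entropy (itinerary T Q m) + shannon_entropy (\<lambda>x. itinerary T Q n ((T ^^ m) x))"
    unfolding itinerary_add[abs_def]
    by (intro shannon_entropy_compose_Pair_le simple_function_iterate simple_function_itinerary)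
  then show ?thesis
    by (simp add: shannon_entropy_iterate simple_function_itinerary)
qed

lemma partition_entropy_rate_LIMSEQ:
  "(\<lambda>n. partition_entropy M (iterated_join M T Q n) / real n)
    \<longlonglongrightarrow> lim (\<lambda>n. partition_entropy M (iterated_join M T Q n) / real n)"
  unfolding convergent_LIMSEQ_iff[symmetric] partition_entropy_iterated_join
  by (intro convergentI[OF fekete] shannon_entropy_itinerary_subadditive bdd_belowI[of _ 0])
    (auto intro!: divide_nonneg_nonneg shannon_entropy_nonneg simple_function_itinerary)

end

section \<open>The full shift\<close>

(* keeps the simplifier from turning the alphabet {1..N} into {Suc 0..N} *)
declare One_nat_def [simp del]

definition prefix_word :: "nat \<Rightarrow> (nat \<Rightarrow> 'a) \<Rightarrow> 'a list" where
  "prefix_word n x = map x [0..<n]"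

lemma length_prefix_word [simp]: "length (prefix_word n x) = n"
  by (simp add: prefix_word_def)

lemma nth_prefix_word [simp]: "i < n \<Longrightarrow> prefix_word n x ! i = x i"
  by (simp add: prefix_word_def)

lemma take_prefix_word: "k \<le> n \<Longrightarrow> take k (prefix_word n x) = prefix_word k x"
  by (simp add: prefix_word_def take_map)

lemma prefix_word_eq_iff: "length w = n \<Longrightarrow> prefix_word n x = w \<longleftrightarrow> (\<forall>i<n. x i = w ! i)"
  by (auto simp: list_eq_iff_nth_eq)

lemma prefix_word_Suc: "prefix_word (Suc n) x = x 0 # prefix_word n (shift x)"
  by (auto simp: list_eq_iff_nth_eq shift_def nth_Cons split: nat.split)

lemma funpow_shift: "(shift ^^ i) x = (\<lambda>n. x (n + i))"
  by (induction i arbitrary: x) (simp_all add: shift_def)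

lemma window_prefix_word:
  assumes "i + k \<le> n"
  shows "take k (drop i (prefix_word n x)) = prefix_word k ((shift ^^ i) x)"
  using assms by (auto simp: list_eq_iff_nth_eq funpow_shift add.commute)

locale full_shift_prob = prob_space \<nu> for \<nu> :: "(nat \<Rightarrow> nat) measure" +
  fixes N :: nat
  assumes sets_nu: "sets \<nu> = sets (full_shift_measure N)"
begin

lemma space_nu: "space \<nu> = {x. \<forall>i. x i \<in> {1..N}}"
  using sets_eq_imp_space_eq[OF sets_nu] by (auto simp: full_shift_measure_def space_PiM PiE_iff)

lemma measurable_coordinate: "(\<lambda>x. x i) \<in> measurable \<nu> (count_space {1..N})"
  unfolding measurable_cong_sets[OF sets_nu refl] full_shift_measure_def
  by (rule measurable_component_singleton) simp

lemma simple_function_coordinate: "simple_function \<nu> (\<lambda>x. x i)"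
  using measurable_coordinate[of i]
  by (auto simp: simple_function_def measurable_count_space_eq2 space_nu
      intro!: finite_subset[of "(\<lambda>x. x i) ` _" "{1..N}"])

lemma simple_function_prefix_word: "simple_function \<nu> (prefix_word n)"
  unfolding prefix_word_def[abs_def] by (intro simple_function_map_upt simple_function_coordinate)

lemma prefix_word_in_words: "prefix_word n \<in> space \<nu> \<rightarrow> words {1..N} n"
  unfolding prefix_word_def[abs_def] by (auto simp: space_nu words_def)

lemmas simple_prefix_word = simple_function_prefix_word finite_words[OF finite_atLeastAtMost]
  prefix_word_in_words

lemma sets_prefix_event: "{x \<in> space \<nu>. prefix_word n x \<in> D} \<in> sets \<nu>"
  using simple_functionD(2)[OF simple_function_prefix_word, of n D]
  by (simp add: vimage_def Int_def conj_commute)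

lemma prob_prefix_event:
  "prob {x \<in> space \<nu>. prefix_word n x \<in> D} = (\<Sum>w\<in>D \<inter> words {1..N} n. point_mass \<nu> (prefix_word n) w)"
proof -
  have "{x \<in> space \<nu>. prefix_word n x \<in> D} = (\<Union>w\<in>D \<inter> words {1..N} n. prefix_word n -` {w} \<inter> space \<nu>)"
    using prefix_word_in_words by auto
  also have "prob \<dots> = (\<Sum>w\<in>D \<inter> words {1..N} n. point_mass \<nu> (prefix_word n) w)"
    by (intro finite_measure_finite_Union)
      (auto simp: disjoint_family_on_def simple_functionD(2)[OF simple_function_prefix_word])
  finally show ?thesis .
qed

definition prefix_events :: "(nat \<Rightarrow> nat) set set" where
  "prefix_events = {{x \<in> space \<nu>. prefix_word n x \<in> D} | n D. True}"

lemma common_prefix_length: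
  assumes "finite J" and "\<And>j. j \<in> J \<Longrightarrow> A j \<in> prefix_events"
  shows "\<exists>n D. \<forall>j\<in>J. A j = {x \<in> space \<nu>. prefix_word n x \<in> D j}"
proof -
  have "\<forall>j\<in>J. \<exists>k D. A j = {x \<in> space \<nu>. prefix_word k x \<in> D}"
    using assms(2) by (auto simp: prefix_events_def)
  then obtain k D where kD: "\<And>j. j \<in> J \<Longrightarrow> A j = {x \<in> space \<nu>. prefix_word (k j) x \<in> D j}"
    by metis
  have "k j \<le> (\<Sum>j\<in>J. k j)" if "j \<in> J" for j
    using that assms(1) by (intro member_le_sum) auto
  then have "A j = {x \<in> space \<nu>. prefix_word (\<Sum>j\<in>J. k j) x \<in> {w. take (k j) w \<in> D j}}" if "j \<in> J" for j
    using kD that by (auto simp: take_prefix_word)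
  then show ?thesis
    by (intro exI ballI)
qed

lemma algebra_prefix_events: "algebra (space \<nu>) prefix_events"
  unfolding algebra_iff_Int
proof (intro conjI ballI)
  show "prefix_events \<subseteq> Pow (space \<nu>)"
    by (auto simp: prefix_events_def)
  have "{} = {x \<in> space \<nu>. prefix_word 0 x \<in> {}}"
    by simp
  then show "{} \<in> prefix_events"
    unfolding prefix_events_def by blast
next
  fix A assume "A \<in> prefix_events"
  then obtain n D where "A = {x \<in> space \<nu>. prefix_word n x \<in> D}"
    by (auto simp: prefix_events_def)
  then have "space \<nu> - A = {x \<in> space \<nu>. prefix_word n x \<in> - D}"
    by auto
  then show "space \<nu> - A \<in> prefix_events"
    unfolding prefix_events_def by blast
next
  fix A B assume "A \<in> prefix_events" "B \<in> prefix_events"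
  then obtain n D where "\<forall>E\<in>{A, B}. E = {x \<in> space \<nu>. prefix_word n x \<in> D E}"
    using common_prefix_length[of "{A, B}" "\<lambda>E. E"] by auto
  then have "A \<inter> B = {x \<in> space \<nu>. prefix_word n x \<in> D A \<inter> D B}"
    by auto
  then show "A \<inter> B \<in> prefix_events"
    unfolding prefix_events_def by blast
qed

lemma sets_eq_sigma_sets_prefix_events: "sets \<nu> = sigma_sets (space \<nu>) prefix_events"
proof
  show "sigma_sets (space \<nu>) prefix_events \<subseteq> sets \<nu>"
    by (intro sets.sigma_sets_subset) (auto simp: prefix_events_def sets_prefix_event)
  have "(\<Pi>\<^sub>E i\<in>UNIV. {1..N}) = space \<nu>"
    by (auto simp: space_nu)
  then have "sets \<nu> = sigma_sets (space \<nu>) {{x \<in> space \<nu>. x i \<in> A} | i A. A \<subseteq> {1..N}}"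
    unfolding sets_nu full_shift_measure_def sets_PiM_single by simp
  moreover have "{x \<in> space \<nu>. x i \<in> A} = {x \<in> space \<nu>. prefix_word (Suc i) x \<in> {w. w ! i \<in> A}}" for i A
    by simp
  then have "{{x \<in> space \<nu>. x i \<in> A} | i A. A \<subseteq> {1..N}} \<subseteq> prefix_events"
    unfolding prefix_events_def by blast
  ultimately show "sets \<nu> \<subseteq> sigma_sets (space \<nu>) prefix_events"
    by (simp add: sigma_sets_mono')
qed

lemma partition_approximation:
  assumes "finite_partition \<nu> Q" and e: "0 < e"
  shows "\<exists>k g. prob {x \<in> space \<nu>. g (prefix_word k x) \<noteq> cell Q x} < e"
proof -
  interpret finite_partition \<nu> Q by fact
  have "\<exists>A\<in>prefix_events. prob (sym_diff S A) < e / Suc (card Q)" if "S \<in> Q" for S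
    by (intro algebra_approximation algebra_prefix_events sets_eq_sigma_sets_prefix_events sets_Q that)
      (simp add: e)
  then obtain A where A: "\<And>S. S \<in> Q \<Longrightarrow> A S \<in> prefix_events"
    and A_near: "\<And>S. S \<in> Q \<Longrightarrow> prob (sym_diff S (A S)) < e / Suc (card Q)"
    by metis
  obtain k D where D: "\<And>S. S \<in> Q \<Longrightarrow> A S = {x \<in> space \<nu>. prefix_word k x \<in> D S}"
    using common_prefix_length[OF finite_Q, of A] A by auto
  define g where "g v = (SOME S. S \<in> Q \<and> v \<in> D S)" for v
  have "g (prefix_word k x) = cell Q x"
    if x: "x \<in> space \<nu>" and good: "\<And>S. S \<in> Q \<Longrightarrow> x \<notin> sym_diff S (A S)" for x
    unfolding g_def
  proof (rule some_equality)
    show "cell Q x \<in> Q \<and> prefix_word k x \<in> D (cell Q x)"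
      using cell_in_Q[OF x] in_cell[OF x] good D by blast
    show "S = cell Q x" if "S \<in> Q \<and> prefix_word k x \<in> D S" for S
      using that good[of S] D x cell_eqI[of S x] by auto
  qed
  then have "prob {x \<in> space \<nu>. g (prefix_word k x) \<noteq> cell Q x} \<le> prob (\<Union>S\<in>Q. sym_diff S (A S))"
    using sets_Q D sets_prefix_event finite_Q
    by (intro finite_measure_mono sets.finite_UN sets.Un sets.Diff) auto
  also have "\<dots> \<le> (\<Sum>S\<in>Q. prob (sym_diff S (A S)))"
    using sets_Q D sets_prefix_event finite_Q by (intro measure_UNION_le sets.Un sets.Diff) auto
  also have "\<dots> \<le> (\<Sum>S\<in>Q. e / Suc (card Q))"
    using A_near by (intro sum_mono less_imp_le) auto
  also have "\<dots> < e"
    using e by (simp add: field_simps)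
  finally show ?thesis
    by blast
qed

lemma measurable_shift: "shift \<in> measurable \<nu> \<nu>"
proof -
  have "(\<lambda>x i. x (Suc i)) \<in> measurable \<nu> (full_shift_measure N)"
    unfolding full_shift_measure_def
    by (rule measurable_PiM_single') (auto simp: measurable_coordinate space_nu)
  then show ?thesis
    unfolding measurable_cong_sets[OF refl sets_nu] by (simp add: shift_def[abs_def])
qed

lemma full_shift_prob_distr_shift: "full_shift_prob (distr \<nu> \<nu> shift) N"
  using prob_space_distr[OF measurable_shift] sets_nu
  by (simp add: full_shift_prob_def full_shift_prob_axioms_def)

lemma sets_shift_space: "shift_space N B \<in> sets \<nu>"
proof -
  have "shift_space N B
      = (\<Inter>i. {x \<in> space \<nu>. prefix_word (Suc (Suc i)) x \<in> {w. B (w ! i) (w ! Suc i) = 1}})"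
    by (auto simp: shift_space_def space_nu)
  also have "\<dots> \<in> sets \<nu>"
    using sets_prefix_event by (intro sets.countable_INT') blast+
  finally show ?thesis .
qed

end

lemma full_shift_prob_eqI:
  assumes "full_shift_prob \<nu> N" and "full_shift_prob \<nu>' N"
    and eq: "\<And>n w. w \<in> words {1..N} n \<Longrightarrow>
      point_mass \<nu> (prefix_word n) w = point_mass \<nu>' (prefix_word n) w"
  shows "\<nu> = \<nu>'"
proof -
  interpret full_shift_prob \<nu> N by fact
  interpret \<nu>': full_shift_prob \<nu>' N by fact
  have space_eq: "space \<nu>' = space \<nu>"
    by (simp add: space_nu \<nu>'.space_nu)
  interpret algebra "space \<nu>" prefix_events
    by (rule algebra_prefix_events)
  show ?thesis
  proof (rule measure_eqI_generator_eq[where E = prefix_events and \<Omega> = "space \<nu>" and A = "\<lambda>_. space \<nu>"])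
    show "Int_stable prefix_events"
      by (auto intro: Int_stableI)
    show "emeasure \<nu> X = emeasure \<nu>' X" if X: "X \<in> prefix_events" for X
    proof -
      obtain n D where X_eq: "X = {x \<in> space \<nu>. prefix_word n x \<in> D}"
        using X by (auto simp: prefix_events_def)
      have "prob X = measure \<nu>' X"
        unfolding X_eq prob_prefix_event using \<nu>'.prob_prefix_event[of n D] eq by (simp add: space_eq)
      then show ?thesis
        by (simp add: emeasure_eq_measure \<nu>'.emeasure_eq_measure)
    qed
    show "sets \<nu> = sigma_sets (space \<nu>) prefix_events"
      by (rule sets_eq_sigma_sets_prefix_events)
    then show "sets \<nu>' = sigma_sets (space \<nu>) prefix_events"
      by (simp add: sets_nu \<nu>'.sets_nu)
  qed (use space_closed in \<open>auto simp: emeasure_space_1\<close>)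
qed

locale shift_invariant_prob = full_shift_prob \<nu> N + measure_preserving \<nu> shift
  for \<nu> :: "(nat \<Rightarrow> nat) measure" and N

lemma invariant_measures_on_iff:
  "\<nu> \<in> invariant_measures_on N Y \<longleftrightarrow> shift_invariant_prob \<nu> N \<and> emeasure \<nu> Y = 1"
  by (auto simp: invariant_measures_on_def shift_invariant_prob_def full_shift_prob_def
      full_shift_prob_axioms_def measure_preserving_def measure_preserving_axioms_def)

lemma invariant_measures_on_AE_in:
  assumes "\<nu> \<in> invariant_measures_on N Y"
  shows "AE x in \<nu>. x \<in> Y"
proof -
  interpret shift_invariant_prob \<nu> N
    using assms by (simp add: invariant_measures_on_iff)
  have Y: "emeasure \<nu> Y = 1"
    using assms by (simp add: invariant_measures_on_iff)
  then have "Y \<in> sets \<nu>"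
    using emeasure_notin_sets[of Y \<nu>] by auto
  then show ?thesis
    using Y prob_eq_1[of Y] by (simp add: emeasure_eq_measure)
qed

lemma invariant_measures_on_empty [simp]: "invariant_measures_on N {} = {}"
  by (auto simp: invariant_measures_on_def)

lemma pressure_empty: "pressure N {} \<phi> = - \<infinity>"
  by (simp add: pressure_def bot_ereal_def)

lemma pressure_cong:
  assumes "\<phi> \<in> borel_measurable (full_shift_measure N)"
    and "\<psi> \<in> borel_measurable (full_shift_measure N)"
    and "\<And>x. x \<in> Y \<Longrightarrow> \<phi> x = \<psi> x"
  shows "pressure N Y \<phi> = pressure N Y \<psi>"
proof -
  have "(\<integral>x. \<phi> x \<partial>\<nu>) = (\<integral>x. \<psi> x \<partial>\<nu>)" if \<nu>: "\<nu> \<in> invariant_measures_on N Y" for \<nu>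
  proof (rule integral_cong_AE)
    have sets: "sets \<nu> = sets (full_shift_measure N)"
      using \<nu> by (simp add: invariant_measures_on_def)
    show "\<phi> \<in> borel_measurable \<nu>" "\<psi> \<in> borel_measurable \<nu>"
      using assms(1,2) unfolding measurable_cong_sets[OF sets refl] .
    show "AE x in \<nu>. \<phi> x = \<psi> x"
      using invariant_measures_on_AE_in[OF \<nu>] by eventually_elim (rule assms(3))
  qed
  then show ?thesis
    by (simp add: pressure_def cong: SUP_cong)
qed

lemma borel_measurable_edge_function:
  fixes f :: "nat \<Rightarrow> nat \<Rightarrow> real"
  shows "(\<lambda>x. f (x 0) (x 1)) \<in> borel_measurable (full_shift_measure N)"
proof -
  have coord: "(\<lambda>x. x i) \<in> measurable (full_shift_measure N) (count_space {1..N})" for i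
    unfolding full_shift_measure_def by (rule measurable_component_singleton) simp
  show ?thesis
    by (intro measurable_compose_countable'[OF _ coord, where f = "\<lambda>a x. f a (x 1)"]
        measurable_compose[OF coord]) auto
qed

section \<open>The letter partition\<close>

context shift_invariant_prob
begin

definition letter :: "nat \<Rightarrow> (nat \<Rightarrow> nat) set" where
  "letter a = {x \<in> space \<nu>. x 0 = a}"

lemma letter_partition: "letter ` {1..N} \<in> finite_measurable_partitions \<nu>"
proof -
  have "letter a \<in> sets \<nu>" for a
    using simple_functionD(2)[OF simple_function_coordinate, of 0 "{a}"]
    by (simp add: letter_def vimage_def Int_def conj_commute)
  moreover have "(\<Union>a\<in>{1..N}. letter a) = space \<nu>"
    by (auto simp: letter_def space_nu)
  moreover have "disjoint (letter ` {1..N})"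
    by (auto simp: disjoint_def letter_def)
  ultimately show ?thesis
    by (auto simp: finite_measurable_partitions_def)
qed

sublocale letters: preserved_partition \<nu> shift "letter ` {1..N}"
  by unfold_locales (rule letter_partition)

lemma inj_on_letter: "inj_on letter {1..N}"
proof (rule inj_onI)
  fix a b assume a: "a \<in> {1..N}" and eq: "letter a = letter b"
  have "(\<lambda>_. a) \<in> letter a"
    using a by (simp add: letter_def space_nu)
  then show "a = b"
    unfolding eq by (simp add: letter_def)
qed

lemma itinerary_letter:
  assumes x: "x \<in> space \<nu>"
  shows "itinerary shift (letter ` {1..N}) n x = map letter (prefix_word n x)"
proof -
  have "cell (letter ` {1..N}) ((shift ^^ i) x) = letter (x i)" for i
    using x by (intro letters.cell_eqI) (auto simp: letter_def space_nu funpow_shift)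
  then show ?thesis
    by (simp add: itinerary_def prefix_word_def)
qed

lemma partition_entropy_letters:
  "partition_entropy \<nu> (iterated_join \<nu> shift (letter ` {1..N}) n) = shannon_entropy (prefix_word n)"
proof -
  interpret information_space \<nu> "exp 1"
    by unfold_locales simp
  have "inj_on (map letter) (words {1..N} n)"
    by (rule inj_on_subset[OF inj_on_mapI[of _ "words {1..N} n"]])
      (auto intro!: inj_on_subset[OF inj_on_letter] simp: words_def)
  then have inj: "inj_on (map letter) (prefix_word n ` space \<nu>)"
    by (rule inj_on_subset) (use prefix_word_in_words in auto)
  have "shannon_entropy (itinerary shift (letter ` {1..N}) n)
      = shannon_entropy (map letter \<circ> prefix_word n)"
    by (intro shannon_entropy_cong letters.simple_function_itinerary) (simp add: itinerary_letter)
  also have "\<dots> = shannon_entropy (prefix_word n)"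
    by (rule entropy_of_inj[OF simple_function_prefix_word inj])
  finally show ?thesis
    unfolding letters.partition_entropy_iterated_join .
qed

lemma letter_entropy_rate_le_ks_entropy:
  assumes "(\<lambda>n. shannon_entropy (prefix_word (Suc n)) / real (Suc n)) \<longlonglongrightarrow> h"
  shows "ereal h \<le> ks_entropy \<nu> shift"
proof -
  have "(\<lambda>n. partition_entropy \<nu> (iterated_join \<nu> shift (letter ` {1..N}) n) / real n) \<longlonglongrightarrow> h"
    using assms unfolding partition_entropy_letters by (rule LIMSEQ_imp_Suc)
  then show ?thesis
    unfolding ks_entropy_def by (intro SUP_upper2[OF letter_partition]) (simp add: limI)
qed

end

section \<open>Weighted words\<close>

definition path_weight :: "('a \<Rightarrow> 'a \<Rightarrow> real) \<Rightarrow> 'a list \<Rightarrow> real" where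
  "path_weight M w = (\<Prod>i<length w - 1. M (w ! i) (w ! Suc i))"

lemma path_weight_eq: "length w = Suc n \<Longrightarrow> path_weight M w = (\<Prod>i<n. M (w ! i) (w ! Suc i))"
  by (simp add: path_weight_def)

lemma path_weight_singleton [simp]: "path_weight M [a] = 1"
  by (simp add: path_weight_def)

lemma path_weight_Cons:
  assumes "length w = Suc n"
  shows "path_weight M (a # w) = M a (w ! 0) * path_weight M w"
  using assms by (simp add: path_weight_def prod.lessThan_Suc_shift del: prod.lessThan_Suc)

lemma path_weight_snoc:
  assumes "length w = Suc n"
  shows "path_weight M (w @ [a]) = path_weight M w * M (w ! n) a"
  using assms by (simp add: path_weight_def nth_append)

lemma path_weight_eq_0_iff:
  "length w = Suc n \<Longrightarrow> path_weight M w = 0 \<longleftrightarrow> (\<exists>i<n. M (w ! i) (w ! Suc i) = 0)"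
  by (auto simp: path_weight_eq)

lemma ln_path_weight:
  assumes "length w = Suc n" and "path_weight M w \<noteq> 0"
  shows "ln (path_weight M w) = (\<Sum>i<n. ln (M (w ! i) (w ! Suc i)))"
  using assms path_weight_eq_0_iff[OF assms(1)] by (auto simp: path_weight_eq intro!: ln_prod)

definition partition_function :: "'a set \<Rightarrow> ('a \<Rightarrow> 'a \<Rightarrow> real) \<Rightarrow> nat \<Rightarrow> real" where
  "partition_function S M n = (\<Sum>w\<in>words S (Suc n). path_weight M w)"

lemma partition_function_0 [simp]: "partition_function S M 0 = real (card S)"
  by (simp add: partition_function_def sum_words_1)

lemma partition_function_Suc:
  "partition_function S M (Suc n) = (\<Sum>w\<in>words S (Suc n). path_weight M w * (\<Sum>a\<in>S. M (w ! n) a))"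
  unfolding partition_function_def sum_words_Suc[of _ S "Suc n"] sum_distrib_left
  by (intro sum.cong refl path_weight_snoc length_words)

lemma partition_function_stochastic:
  assumes "\<And>i. i \<in> S \<Longrightarrow> (\<Sum>j\<in>S. M i j) = 1"
  shows "partition_function S M n = real (card S)"
proof (induction n)
  case (Suc n)
  have "partition_function S M (Suc n) = (\<Sum>w\<in>words S (Suc n). path_weight M w * 1)"
    unfolding partition_function_Suc
    by (intro sum.cong refl) (simp add: assms nth_words)
  then show ?case
    using Suc by (simp add: partition_function_def)
qed simp

locale nonneg_matrix =
  fixes S :: "'a set" and W :: "'a \<Rightarrow> 'a \<Rightarrow> real"
  assumes finite_S: "finite S" and W_nonneg: "\<And>i j. i \<in> S \<Longrightarrow> j \<in> S \<Longrightarrow> 0 \<le> W i j"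
begin

abbreviation Z :: "nat \<Rightarrow> real" where
  "Z \<equiv> partition_function S W"

lemma path_weight_nonneg: "w \<in> words S n \<Longrightarrow> 0 \<le> path_weight W w"
  unfolding path_weight_def
  by (intro prod_nonneg ballI W_nonneg) (auto simp: length_words intro!: nth_words)

lemma partition_function_nonneg: "0 \<le> Z n"
  unfolding partition_function_def by (intro sum_nonneg path_weight_nonneg)

lemma partition_function_pos_iff: "0 < Z n \<longleftrightarrow> (\<exists>w\<in>words S (Suc n). 0 < path_weight W w)"
proof -
  have "Z n = 0 \<longleftrightarrow> (\<forall>w\<in>words S (Suc n). path_weight W w = 0)"
    unfolding partition_function_def using finite_S path_weight_nonneg
    by (intro sum_nonneg_eq_0_iff) auto
  then show ?thesis
    using partition_function_nonneg[of n] path_weight_nonneg by (force simp: less_le)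
qed

lemma partition_function_add_le:
  assumes "0 \<le> R" and R: "\<And>i. i \<in> S \<Longrightarrow> (\<Sum>j\<in>S. W i j) \<le> R"
  shows "Z (n + k) \<le> R ^ k * Z n"
proof (induction k)
  case (Suc k)
  have "Z (Suc (n + k)) \<le> (\<Sum>w\<in>words S (Suc (n + k)). path_weight W w * R)"
    unfolding partition_function_Suc
    by (intro sum_mono mult_left_mono R path_weight_nonneg) (auto intro: nth_words)
  also have "\<dots> = R * Z (n + k)"
    by (simp add: partition_function_def sum_distrib_left mult.commute)
  also have "\<dots> \<le> R * (R ^ k * Z n)"
    using Suc \<open>0 \<le> R\<close> by (rule mult_left_mono)
  finally show ?case
    by simp
qed simp

lemma exists_row_sum_bound: "\<exists>R>0. \<forall>i\<in>S. (\<Sum>j\<in>S. W i j) \<le> R"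
proof (intro exI conjI ballI)
  show "0 < 1 + (\<Sum>i\<in>S. \<Sum>j\<in>S. W i j)"
    by (intro add_pos_nonneg sum_nonneg W_nonneg) auto
  fix i assume "i \<in> S"
  then have "(\<Sum>j\<in>S. W i j) \<le> (\<Sum>i\<in>S. \<Sum>j\<in>S. W i j)"
    using finite_S W_nonneg by (intro member_le_sum sum_nonneg) auto
  then show "(\<Sum>j\<in>S. W i j) \<le> 1 + (\<Sum>i\<in>S. \<Sum>j\<in>S. W i j)"
    by simp
qed

lemma partition_function_eq_0_mono:
  assumes "Z n = 0" and "n \<le> m"
  shows "Z m = 0"
proof -
  obtain R where R: "0 < R" "\<forall>i\<in>S. (\<Sum>j\<in>S. W i j) \<le> R"
    using exists_row_sum_bound by auto
  then have "Z (n + (m - n)) \<le> R ^ (m - n) * Z n"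
    by (intro partition_function_add_le) auto
  then show ?thesis
    using assms partition_function_nonneg[of m] by simp
qed

lemma weighted_partition_function_bounds:
  assumes S: "S \<noteq> {}" and v_pos: "\<And>i. i \<in> S \<Longrightarrow> 0 < v i"
  shows "\<exists>c C. 0 < c \<and> 0 < C \<and> (\<forall>n. c * Z n \<le> (\<Sum>w\<in>words S (Suc n). v (w ! 0) * path_weight W w)
    \<and> (\<Sum>w\<in>words S (Suc n). v (w ! 0) * path_weight W w) \<le> C * Z n)"
proof (intro exI conjI allI)
  have first: "w ! 0 \<in> S" if "w \<in> words S (Suc n)" for w n
    using nth_words[OF that] by simp
  show Min_pos: "0 < Min (v ` S)" and "0 < Max (v ` S)"
    using S v_pos finite_S by (auto simp: Max_gr_iff)
  show "Min (v ` S) * Z n \<le> (\<Sum>w\<in>words S (Suc n). v (w ! 0) * path_weight W w)" for n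
    unfolding partition_function_def sum_distrib_left using finite_S first
    by (intro sum_mono mult_right_mono path_weight_nonneg) auto
  show "(\<Sum>w\<in>words S (Suc n). v (w ! 0) * path_weight W w) \<le> Max (v ` S) * Z n" for n
    unfolding partition_function_def sum_distrib_left using finite_S first
    by (intro sum_mono mult_right_mono path_weight_nonneg) auto
qed

end

section \<open>Edge laws\<close>

definition edge_source :: "'a set \<Rightarrow> ('a \<Rightarrow> 'a \<Rightarrow> real) \<Rightarrow> 'a \<Rightarrow> real" where
  "edge_source S q i = (\<Sum>j\<in>S. q i j)"

(* a state that never occurs as a source gets the source distribution as its row,
   so that every row of the kernel sums to 1 *)
definition edge_kernel :: "'a set \<Rightarrow> ('a \<Rightarrow> 'a \<Rightarrow> real) \<Rightarrow> 'a \<Rightarrow> 'a \<Rightarrow> real" where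
  "edge_kernel S q i j
    = (if edge_source S q i = 0 then edge_source S q j else q i j / edge_source S q i)"

definition edge_pressure :: "'a set \<Rightarrow> ('a \<Rightarrow> 'a \<Rightarrow> real) \<Rightarrow> ('a \<Rightarrow> 'a \<Rightarrow> real) \<Rightarrow> real" where
  "edge_pressure S W q = (\<Sum>i\<in>S. \<Sum>j\<in>S. q i j * (ln (W i j) - ln (edge_kernel S q i j)))"

locale edge_law =
  fixes S :: "'a set" and q :: "'a \<Rightarrow> 'a \<Rightarrow> real"
  assumes finite_S: "finite S"
    and q_nonneg: "\<And>i j. i \<in> S \<Longrightarrow> j \<in> S \<Longrightarrow> 0 \<le> q i j"
    and q_sum: "(\<Sum>i\<in>S. \<Sum>j\<in>S. q i j) = 1"
begin

abbreviation "\<pi> \<equiv> edge_source S q"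
abbreviation "K \<equiv> edge_kernel S q"

lemma edge_source_nonneg: "i \<in> S \<Longrightarrow> 0 \<le> \<pi> i"
  unfolding edge_source_def by (intro sum_nonneg q_nonneg)

lemma sum_edge_source: "(\<Sum>i\<in>S. \<pi> i) = 1"
  using q_sum by (simp add: edge_source_def)

lemma q_le_edge_source: "i \<in> S \<Longrightarrow> j \<in> S \<Longrightarrow> q i j \<le> \<pi> i"
  unfolding edge_source_def using finite_S q_nonneg by (intro member_le_sum) auto

lemma q_le_1: "i \<in> S \<Longrightarrow> j \<in> S \<Longrightarrow> q i j \<le> 1"
  using q_le_edge_source[of i j] member_le_sum[of i S \<pi>] edge_source_nonneg finite_S sum_edge_source
  by fastforce

lemma edge_source_mult_kernel: "i \<in> S \<Longrightarrow> j \<in> S \<Longrightarrow> \<pi> i * K i j = q i j"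
  using q_le_edge_source[of i j] q_nonneg[of i j] by (auto simp: edge_kernel_def)

lemma edge_kernel_nonneg: "i \<in> S \<Longrightarrow> j \<in> S \<Longrightarrow> 0 \<le> K i j"
  using edge_source_nonneg q_nonneg by (auto simp: edge_kernel_def)

lemma sum_edge_kernel: "(\<Sum>j\<in>S. K i j) = 1"
proof (cases "\<pi> i = 0")
  case False
  then have "(\<Sum>j\<in>S. K i j) = (\<Sum>j\<in>S. q i j) / \<pi> i"
    by (simp add: edge_kernel_def sum_divide_distrib)
  then show ?thesis
    using False by (simp add: edge_source_def)
qed (simp add: edge_kernel_def sum_edge_source)

lemma edge_pressure_eq:
  "edge_pressure S W q
    = (\<Sum>i\<in>S. \<Sum>j\<in>S. q i j * ln (W i j) - q i j * ln (q i j)) + (\<Sum>i\<in>S. \<pi> i * ln (\<pi> i))"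
proof -
  have "q i j * ln (K i j) = q i j * ln (q i j) - q i j * ln (\<pi> i)" if "i \<in> S" "j \<in> S" for i j
    using q_le_edge_source[OF that] q_nonneg[OF that]
    by (cases "q i j = 0") (auto simp: edge_kernel_def ln_div right_diff_distrib)
  then have "edge_pressure S W q
      = (\<Sum>i\<in>S. \<Sum>j\<in>S. q i j * ln (W i j) - q i j * ln (q i j) + q i j * ln (\<pi> i))"
    unfolding edge_pressure_def by (intro sum.cong refl) (simp add: right_diff_distrib)
  then show ?thesis
    by (simp add: sum.distrib sum_distrib_right edge_source_def)
qed

end

lemma tendsto_edge_pressure:
  assumes "\<And>n. edge_law S (q n)" and "edge_law S q'"
    and lim: "\<And>i j. i \<in> S \<Longrightarrow> j \<in> S \<Longrightarrow> ((\<lambda>n. q n i j) \<longlongrightarrow> q' i j) F"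
  shows "((\<lambda>n. edge_pressure S W (q n)) \<longlongrightarrow> edge_pressure S W q') F"
  unfolding edge_law.edge_pressure_eq[OF assms(1)] edge_law.edge_pressure_eq[OF assms(2)]
    edge_source_def
  by (intro tendsto_intros lim isCont_tendsto_compose[OF isCont_mult_ln])

locale stationary_edge_law = edge_law +
  assumes q_stationary: "\<And>i. i \<in> S \<Longrightarrow> (\<Sum>j\<in>S. q j i) = (\<Sum>j\<in>S. q i j)"
begin

lemma edge_source_stationary: "j \<in> S \<Longrightarrow> (\<Sum>i\<in>S. \<pi> i * K i j) = \<pi> j"
  using q_stationary[of j] edge_source_mult_kernel by (simp add: edge_source_def)

end

section \<open>Growth of the partition function\<close>

definition edge_count :: "'a list \<Rightarrow> 'a \<Rightarrow> 'a \<Rightarrow> nat" where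
  "edge_count w i j = card {t. Suc t < length w \<and> w ! t = i \<and> w ! Suc t = j}"

lemma edge_count_pos_iff: "0 < edge_count w i j \<longleftrightarrow> (\<exists>t. Suc t < length w \<and> w ! t = i \<and> w ! Suc t = j)"
proof -
  have "finite {t. Suc t < length w \<and> w ! t = i \<and> w ! Suc t = j}"
    by (rule finite_subset[of _ "{..<length w}"]) auto
  then show ?thesis
    by (auto simp: edge_count_def card_gt_0_iff)
qed

lemma sum_edge_count:
  fixes g :: "'a \<Rightarrow> 'a \<Rightarrow> real"
  assumes S: "finite S" and w: "w \<in> words S (Suc n)"
  shows "(\<Sum>i\<in>S. \<Sum>j\<in>S. real (edge_count w i j) * g i j) = (\<Sum>t<n. g (w ! t) (w ! Suc t))"
proof -
  let ?e = "\<lambda>t. (w ! t, w ! Suc t)"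
  have "real (edge_count w i j) * g i j = (\<Sum>t\<in>{t\<in>{..<n}. ?e t = (i, j)}. g (w ! t) (w ! Suc t))" for i j
  proof -
    have "{t. Suc t < length w \<and> w ! t = i \<and> w ! Suc t = j} = {t\<in>{..<n}. ?e t = (i, j)}"
      using length_words[OF w] by auto
    then show ?thesis
      by (simp add: edge_count_def)
  qed
  then have "(\<Sum>i\<in>S. \<Sum>j\<in>S. real (edge_count w i j) * g i j)
      = (\<Sum>e\<in>S \<times> S. \<Sum>t\<in>{t\<in>{..<n}. ?e t = e}. g (w ! t) (w ! Suc t))"
    unfolding sum.cartesian_product' by (intro sum.cong refl) simp
  also have "\<dots> = (\<Sum>t<n. g (w ! t) (w ! Suc t))"
    using S by (intro sum.group) (auto intro: nth_words[OF w])
  finally show ?thesis .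
qed

lemma edge_count_balance:
  assumes S: "finite S" and w: "w \<in> words S (Suc n)" and i: "i \<in> S"
  shows "(\<Sum>j\<in>S. real (edge_count w i j)) - (\<Sum>j\<in>S. real (edge_count w j i))
    = of_bool (w ! 0 = i) - of_bool (w ! n = i)"
proof -
  have "(\<Sum>a\<in>S. \<Sum>b\<in>S. real (edge_count w a b) * of_bool (a = i))
      = (\<Sum>a\<in>S. if a = i then \<Sum>b\<in>S. real (edge_count w a b) else 0)"
    by (intro sum.cong refl) simp
  then have "(\<Sum>j\<in>S. real (edge_count w i j)) = (\<Sum>t<n. of_bool (w ! t = i))"
    using S i by (simp only: sum_edge_count[OF S w] sum.delta if_True)
  moreover have "(\<Sum>a\<in>S. \<Sum>b\<in>S. real (edge_count w a b) * of_bool (b = i))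
      = (\<Sum>a\<in>S. \<Sum>b\<in>S. if b = i then real (edge_count w a b) else 0)"
    by (intro sum.cong refl) simp
  then have "(\<Sum>j\<in>S. real (edge_count w j i)) = (\<Sum>t<n. of_bool (w ! Suc t = i))"
    using S i by (simp only: sum_edge_count[OF S w] sum.delta if_True)
  moreover have "(\<Sum>t<n. of_bool (w ! t = i) - of_bool (w ! Suc t = i) :: real)
      = of_bool (w ! 0 = i) - of_bool (w ! n = i)"
    by (rule sum_lessThan_telescope')
  ultimately show ?thesis
    by (simp add: sum_subtractf)
qed

locale nonvanishing_matrix = nonneg_matrix +
  assumes partition_function_pos: "\<And>n. 0 < Z n"
begin

definition word_law :: "nat \<Rightarrow> 'a list \<Rightarrow> real" where
  "word_law n w = path_weight W w / Z n"

definition mean_edge :: "nat \<Rightarrow> 'a \<Rightarrow> 'a \<Rightarrow> real" where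
  "mean_edge n i j = (\<Sum>w\<in>words S (Suc n). word_law n w * real (edge_count w i j)) / real n"

lemma word_law_nonneg: "w \<in> words S (Suc n) \<Longrightarrow> 0 \<le> word_law n w"
  by (simp add: word_law_def path_weight_nonneg partition_function_nonneg)

lemma word_law_eq_0_iff: "word_law n w = 0 \<longleftrightarrow> path_weight W w = 0"
  using partition_function_pos[of n] by (simp add: word_law_def)

lemma sum_word_law: "(\<Sum>w\<in>words S (Suc n). word_law n w) = 1"
  using partition_function_pos[of n]
  by (simp add: word_law_def sum_divide_distrib[symmetric] partition_function_def)

lemma mean_edge_nonneg: "0 \<le> mean_edge n i j"
  unfolding mean_edge_def
  by (intro divide_nonneg_nonneg sum_nonneg mult_nonneg_nonneg word_law_nonneg) auto

lemma mean_edge_pos_iff: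
  assumes "0 < n"
  shows "0 < mean_edge n i j \<longleftrightarrow> (\<exists>w\<in>words S (Suc n). word_law n w \<noteq> 0 \<and> 0 < edge_count w i j)"
proof -
  have "0 < mean_edge n i j \<longleftrightarrow> mean_edge n i j \<noteq> 0"
    using mean_edge_nonneg[of n i j] by linarith
  also have "\<dots> \<longleftrightarrow> \<not> (\<forall>w\<in>words S (Suc n). word_law n w * real (edge_count w i j) = 0)"
    unfolding mean_edge_def using assms finite_S word_law_nonneg
    by (simp add: sum_nonneg_eq_0_iff)
  also have "\<dots> \<longleftrightarrow> (\<exists>w\<in>words S (Suc n). word_law n w \<noteq> 0 \<and> 0 < edge_count w i j)"
    by auto
  finally show ?thesis .
qed

lemma mean_edge_supp:
  assumes "0 < n" and "0 < mean_edge n i j"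
  shows "W i j \<noteq> 0"
proof -
  obtain w where w: "w \<in> words S (Suc n)" "path_weight W w \<noteq> 0" "0 < edge_count w i j"
    using assms(2) unfolding mean_edge_pos_iff[OF assms(1)] word_law_eq_0_iff by blast
  then show ?thesis
    using path_weight_eq_0_iff[OF length_words[OF w(1)]] length_words[OF w(1)]
    by (auto simp: edge_count_pos_iff)
qed

lemma sum_mean_edge:
  "(\<Sum>i\<in>S. \<Sum>j\<in>S. mean_edge n i j * g i j)
    = (\<Sum>w\<in>words S (Suc n). word_law n w * (\<Sum>t<n. g (w ! t) (w ! Suc t))) / real n"
proof -
  have "(\<Sum>i\<in>S. \<Sum>j\<in>S. mean_edge n i j * g i j)
      = (\<Sum>i\<in>S. \<Sum>j\<in>S. \<Sum>w\<in>words S (Suc n). word_law n w * (real (edge_count w i j) * g i j)) / real n"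
    by (simp add: mean_edge_def sum_distrib_right sum_divide_distrib mult.assoc)
  also have "(\<Sum>i\<in>S. \<Sum>j\<in>S. \<Sum>w\<in>words S (Suc n). word_law n w * (real (edge_count w i j) * g i j))
      = (\<Sum>w\<in>words S (Suc n). word_law n w * (\<Sum>i\<in>S. \<Sum>j\<in>S. real (edge_count w i j) * g i j))"
    unfolding sum_distrib_left by (simp only: sum.swap[of _ "words S (Suc n)"])
  finally show ?thesis
    by (simp add: sum_edge_count[OF finite_S])
qed

lemma edge_law_mean_edge:
  assumes "0 < n"
  shows "edge_law S (mean_edge n)"
proof
  show "(\<Sum>i\<in>S. \<Sum>j\<in>S. mean_edge n i j) = 1"
    using sum_mean_edge[of n "\<lambda>_ _. 1"] assms by (simp add: sum_distrib_right[symmetric] sum_word_law)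
qed (auto simp: finite_S mean_edge_nonneg)

lemma mean_edge_nearly_stationary:
  assumes i: "i \<in> S"
  shows "\<bar>(\<Sum>j\<in>S. mean_edge n i j) - (\<Sum>j\<in>S. mean_edge n j i)\<bar> \<le> 1 / real n"
proof -
  let ?d = "\<lambda>w. of_bool (w ! 0 = i) - of_bool (w ! n = i) :: real"
  have sum_mean: "(\<Sum>j\<in>S. (\<Sum>w\<in>words S (Suc n). word_law n w * c w j) / real n)
      = (\<Sum>w\<in>words S (Suc n). word_law n w * (\<Sum>j\<in>S. c w j)) / real n" for c :: "'a list \<Rightarrow> 'a \<Rightarrow> real"
    unfolding sum_divide_distrib[symmetric] by (subst sum.swap) (simp only: sum_distrib_left)
  have "(\<Sum>j\<in>S. mean_edge n i j) - (\<Sum>j\<in>S. mean_edge n j i)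
      = (\<Sum>w\<in>words S (Suc n). word_law n w *
          ((\<Sum>j\<in>S. real (edge_count w i j)) - (\<Sum>j\<in>S. real (edge_count w j i)))) / real n"
    unfolding mean_edge_def sum_mean
    by (simp only: right_diff_distrib sum_subtractf diff_divide_distrib)
  also have "\<dots> = (\<Sum>w\<in>words S (Suc n). word_law n w * ?d w) / real n"
    using edge_count_balance[OF finite_S _ i] by simp
  also have "\<bar>\<dots>\<bar> \<le> (\<Sum>w\<in>words S (Suc n). word_law n w) / real n"
    unfolding abs_divide abs_of_nat
    by (intro divide_right_mono order_trans[OF sum_abs] sum_mono)
      (auto simp: abs_mult word_law_nonneg)
  finally show ?thesis
    by (simp only: sum_word_law)
qed

lemma sum_word_law_ln_path_weight:
  assumes "0 < n" and ac: "\<And>w. w \<in> words S (Suc n) \<Longrightarrow> word_law n w \<noteq> 0 \<Longrightarrow> path_weight M w \<noteq> 0"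
  shows "(\<Sum>w\<in>words S (Suc n). word_law n w * ln (path_weight M w))
    = real n * (\<Sum>i\<in>S. \<Sum>j\<in>S. mean_edge n i j * ln (M i j))"
proof -
  have "word_law n w * ln (path_weight M w) = word_law n w * (\<Sum>t<n. ln (M (w ! t) (w ! Suc t)))"
    if w: "w \<in> words S (Suc n)" for w
    using ac[OF w] ln_path_weight[OF length_words[OF w]] by (cases "word_law n w = 0") auto
  then have "(\<Sum>w\<in>words S (Suc n). word_law n w * ln (path_weight M w))
      = (\<Sum>w\<in>words S (Suc n). word_law n w * (\<Sum>t<n. ln (M (w ! t) (w ! Suc t))))"
    by (rule sum.cong[OF refl])
  then show ?thesis
    unfolding sum_mean_edge using \<open>0 < n\<close> by simp
qed

lemma card_pos: "0 < card S"
  using partition_function_pos[of 0] by simp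

lemma path_weight_edge_kernel_mean_edge_pos:
  assumes n: "0 < n" and w: "w \<in> words S (Suc n)" and "word_law n w \<noteq> 0"
  shows "0 < path_weight (edge_kernel S (mean_edge n)) w"
proof -
  interpret edge_law S "mean_edge n"
    using n by (rule edge_law_mean_edge)
  have "0 < K (w ! t) (w ! Suc t)" if t: "t < n" for t
  proof -
    have wt: "w ! t \<in> S" "w ! Suc t \<in> S"
      using nth_words[OF w] t by auto
    have "0 < edge_count w (w ! t) (w ! Suc t)"
      unfolding edge_count_pos_iff using t length_words[OF w] by auto
    then have "0 < mean_edge n (w ! t) (w ! Suc t)"
      using assms by (auto simp: mean_edge_pos_iff)
    then show ?thesis
      using edge_source_mult_kernel[OF wt] edge_kernel_nonneg[OF wt] by (metis less_le mult_zero_right)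
  qed
  then show ?thesis
    unfolding path_weight_eq[OF length_words[OF w]] by (intro prod_pos) simp
qed

lemma ln_partition_function_le_edge_pressure:
  assumes n: "0 < n"
  shows "ln (Z n) \<le> ln (real (card S)) + real n * edge_pressure S W (mean_edge n)"
proof -
  let ?I = "words S (Suc n)"
  interpret edge_law S "mean_edge n"
    using n by (rule edge_law_mean_edge)
  interpret K: nonneg_matrix S K
    by unfold_locales (auto simp: finite_S edge_kernel_nonneg)
  have K_pos: "0 < path_weight K w" if "w \<in> ?I" "word_law n w \<noteq> 0" for w
    using n that by (rule path_weight_edge_kernel_mean_edge_pos)
  have "(\<Sum>w\<in>?I. word_law n w * ln (path_weight K w / real (card S)))
      \<le> (\<Sum>w\<in>?I. word_law n w * ln (word_law n w))"
  proof (rule gibbs_inequality)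
    show "(\<Sum>w\<in>?I. path_weight K w / real (card S)) \<le> (\<Sum>w\<in>?I. word_law n w)"
      using partition_function_stochastic[of S K n, OF sum_edge_kernel] card_pos
      by (simp add: sum_word_law sum_divide_distrib[symmetric] partition_function_def)
  qed (auto simp: word_law_nonneg K.path_weight_nonneg K_pos card_pos)
  moreover have "word_law n w * ln (path_weight K w / real (card S))
      = word_law n w * ln (path_weight K w) - word_law n w * ln (real (card S))" if "w \<in> ?I" for w
    using K_pos[OF that] card_pos by (cases "word_law n w = 0") (auto simp: ln_div right_diff_distrib)
  moreover have "word_law n w * ln (word_law n w)
      = word_law n w * ln (path_weight W w) - word_law n w * ln (Z n)" for w
    using partition_function_pos[of n] word_law_eq_0_iff[of n w]
    by (cases "word_law n w = 0") (auto simp: word_law_def ln_div right_diff_distrib)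
  ultimately have "(\<Sum>w\<in>?I. word_law n w * ln (path_weight K w)) - ln (real (card S))
      \<le> (\<Sum>w\<in>?I. word_law n w * ln (path_weight W w)) - ln (Z n)"
    by (simp add: sum_subtractf sum_distrib_right[symmetric] sum_word_law)
  moreover have "(\<Sum>w\<in>?I. word_law n w * ln (path_weight K w))
      = real n * (\<Sum>i\<in>S. \<Sum>j\<in>S. mean_edge n i j * ln (K i j))"
    using n K_pos by (intro sum_word_law_ln_path_weight) force+
  moreover have "(\<Sum>w\<in>?I. word_law n w * ln (path_weight W w))
      = real n * (\<Sum>i\<in>S. \<Sum>j\<in>S. mean_edge n i j * ln (W i j))"
    using n word_law_eq_0_iff by (intro sum_word_law_ln_path_weight) auto
  ultimately show ?thesis
    by (simp add: edge_pressure_def sum_subtractf right_diff_distrib)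
qed

lemma stationary_edge_law_limit:
  assumes r: "strict_mono r"
    and lim: "\<And>i j. i \<in> S \<Longrightarrow> j \<in> S \<Longrightarrow> (\<lambda>n. mean_edge (Suc (r n)) i j) \<longlonglongrightarrow> q i j"
  shows "stationary_edge_law S q"
proof
  show "finite S"
    by (rule finite_S)
  show "0 \<le> q i j" if "i \<in> S" "j \<in> S" for i j
    using lim[OF that] by (rule LIMSEQ_le_const) (auto simp: mean_edge_nonneg)
  have "(\<lambda>n. \<Sum>i\<in>S. \<Sum>j\<in>S. mean_edge (Suc (r n)) i j) \<longlonglongrightarrow> (\<Sum>i\<in>S. \<Sum>j\<in>S. q i j)"
    by (intro tendsto_sum lim)
  then show "(\<Sum>i\<in>S. \<Sum>j\<in>S. q i j) = 1"
    using edge_law.q_sum[OF edge_law_mean_edge] by (simp add: LIMSEQ_const_iff)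
  fix i assume i: "i \<in> S"
  have "(\<lambda>n. (\<Sum>j\<in>S. mean_edge (Suc (r n)) i j) - (\<Sum>j\<in>S. mean_edge (Suc (r n)) j i))
      \<longlonglongrightarrow> (\<Sum>j\<in>S. q i j) - (\<Sum>j\<in>S. q j i)"
    using i by (intro tendsto_diff tendsto_sum lim)
  moreover have "(\<lambda>n. (\<Sum>j\<in>S. mean_edge (Suc (r n)) i j) - (\<Sum>j\<in>S. mean_edge (Suc (r n)) j i)) \<longlonglongrightarrow> 0"
  proof (rule Lim_null_comparison)
    show "(\<lambda>n. 1 / real (Suc (r n))) \<longlonglongrightarrow> 0"
      using LIMSEQ_subseq_LIMSEQ[OF LIMSEQ_Suc[OF lim_const_over_n] r] by (simp add: comp_def)
  qed (use mean_edge_nearly_stationary[OF i] in \<open>simp del: of_nat_Suc\<close>)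
  ultimately show "(\<Sum>j\<in>S. q j i) = (\<Sum>j\<in>S. q i j)"
    using LIMSEQ_unique by fastforce
qed

lemma exists_subseq_mean_edge_convergent:
  fixes r :: "nat \<Rightarrow> nat"
  shows "\<exists>q s. strict_mono (s :: nat \<Rightarrow> nat)
    \<and> (\<forall>i\<in>S. \<forall>j\<in>S. (\<lambda>n. mean_edge (Suc (r (s n))) i j) \<longlonglongrightarrow> q i j)"
proof -
  have "mean_edge (Suc (r n)) i j \<in> {0..1}" if "(i, j) \<in> S \<times> S" for n i j
    using that edge_law.q_le_1[OF edge_law_mean_edge, of "Suc (r n)" i j]
    by (simp add: mean_edge_nonneg)
  then obtain l and s :: "nat \<Rightarrow> nat" where "strict_mono s"
    "\<forall>e\<in>S \<times> S. (\<lambda>n. mean_edge (Suc (r (s n))) (fst e) (snd e)) \<longlonglongrightarrow> l e"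
    using finite_family_convergent_subseq[of "S \<times> S" "{0..1::real}"
      "\<lambda>n e. mean_edge (Suc (r n)) (fst e) (snd e)"]
      finite_S by auto
  then show ?thesis
    by (intro exI[of _ "\<lambda>i j. l (i, j)"] exI[of _ s]) auto
qed

lemma exists_optimal_edge_law:
  "\<exists>q. stationary_edge_law S q \<and> (\<forall>i\<in>S. \<forall>j\<in>S. W i j = 0 \<longrightarrow> q i j = 0) \<and>
    limsup (\<lambda>n. ereal (ln (Z (Suc n)) / real (Suc n))) \<le> ereal (edge_pressure S W q)"
proof -
  let ?u = "\<lambda>n. ereal (ln (Z (Suc n)) / real (Suc n))"
  obtain r :: "nat \<Rightarrow> nat" where r: "strict_mono r" "(?u \<circ> r) \<longlonglongrightarrow> limsup ?u"
    using limsup_subseq_lim[of ?u] by blast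
  obtain q and s :: "nat \<Rightarrow> nat" where s: "strict_mono s"
    and q: "\<And>i j. i \<in> S \<Longrightarrow> j \<in> S \<Longrightarrow> (\<lambda>n. mean_edge (Suc (r (s n))) i j) \<longlonglongrightarrow> q i j"
    using exists_subseq_mean_edge_convergent[of r] by auto
  have rs: "strict_mono (\<lambda>n. r (s n))"
    using strict_mono_o[OF r(1) s] by (simp add: comp_def)
  have stationary: "stationary_edge_law S q"
    using rs q by (rule stationary_edge_law_limit)
  have supp: "q i j = 0" if ij: "i \<in> S" "j \<in> S" and "W i j = 0" for i j
  proof -
    have "mean_edge (Suc n) i j = 0" for n
      using \<open>W i j = 0\<close> mean_edge_supp[of "Suc n" i j] mean_edge_nonneg[of "Suc n" i j] by force
    then show ?thesis
      using q[OF ij] by (simp add: LIMSEQ_const_iff)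
  qed
  let ?v = "\<lambda>n. ln (real (card S)) / real (Suc (r (s n)))
      + edge_pressure S W (mean_edge (Suc (r (s n))))"
  have "?v \<longlonglongrightarrow> 0 + edge_pressure S W q"
    using LIMSEQ_subseq_LIMSEQ[OF LIMSEQ_Suc[OF lim_const_over_n] rs]
    by (intro tendsto_add tendsto_edge_pressure edge_law_mean_edge q
        stationary_edge_law.axioms(1)[OF stationary]) (simp_all add: comp_def)
  then have v: "(\<lambda>n. ereal (?v n)) \<longlonglongrightarrow> ereal (edge_pressure S W q)"
    by simp
  have "?u (r (s n)) \<le> ereal (?v n)" for n
    using ln_partition_function_le_edge_pressure[of "Suc (r (s n))"]
    by (simp add: divide_le_eq distrib_right mult.commute[of _ "real _"] distrib_left del: of_nat_Suc)
  then have "limsup ?u \<le> ereal (edge_pressure S W q)"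
    by (intro LIMSEQ_le[OF LIMSEQ_subseq_LIMSEQ[OF r(2) s] v]) auto
  then show ?thesis
    using stationary supp by blast
qed

end

section \<open>Markov measures\<close>

locale markov_prob = full_shift_prob +
  fixes \<pi> :: "nat \<Rightarrow> real" and K :: "nat \<Rightarrow> nat \<Rightarrow> real"
  assumes point_mass_prefix_word: "\<And>n w. w \<in> words {1..N} (Suc n) \<Longrightarrow>
    point_mass \<nu> (prefix_word (Suc n)) w = \<pi> (w ! 0) * path_weight K w"

primrec random_map_orbit :: "(nat \<times> nat \<Rightarrow> nat) \<Rightarrow> nat \<Rightarrow> nat" where
  "random_map_orbit \<omega> 0 = \<omega> (0, 0)"
| "random_map_orbit \<omega> (Suc n) = \<omega> (Suc n, random_map_orbit \<omega> n)"

text \<open>The chain is realised by independent random maps: given independent \<open>\<omega>(n, i)\<close> with law \<open>K i\<close>,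
  put \<open>x\<^sub>n = \<omega>(n, x\<^sub>n\<^sub>-\<^sub>1)\<close>. The letter \<open>0\<close>, outside the alphabet, serves as the state before the
  first one, and its row is the initial distribution.\<close>

locale markov_chain =
  fixes N :: nat and \<pi> :: "nat \<Rightarrow> real" and K :: "nat \<Rightarrow> nat \<Rightarrow> real"
  assumes initial_nonneg: "\<And>i. i \<in> {1..N} \<Longrightarrow> 0 \<le> \<pi> i" and initial_sum: "(\<Sum>i\<in>{1..N}. \<pi> i) = 1"
    and stochastic: "row_stochastic N K"
begin

definition transition_row :: "nat \<Rightarrow> nat \<Rightarrow> real" where
  "transition_row i = (if i \<in> {1..N} then K i else \<pi>)"

definition map_law :: "nat \<times> nat \<Rightarrow> nat measure" where
  "map_law z = point_measure {1..N} (\<lambda>j. ennreal (transition_row (snd z) j))"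

definition chain :: "(nat \<Rightarrow> nat) measure" where
  "chain = distr (PiM UNIV map_law) (full_shift_measure N) random_map_orbit"

lemma transition_row_nonneg: "j \<in> {1..N} \<Longrightarrow> 0 \<le> transition_row i j"
  using initial_nonneg stochastic by (auto simp: transition_row_def row_stochastic_def)

lemma sum_transition_row: "(\<Sum>j\<in>{1..N}. transition_row i j) = 1"
  using initial_sum stochastic by (simp add: transition_row_def row_stochastic_def)

lemma prob_space_map_law: "prob_space (map_law z)"
  unfolding map_law_def
proof (rule prob_space_point_measure)
  show "(\<Sum>j\<in>{1..N}. ennreal (transition_row (snd z) j)) = 1"
    using sum_ennreal[of "{1..N}" "transition_row (snd z)"] transition_row_nonneg sum_transition_row
    by simp
qed simp_all

lemma sets_map_law [simp]: "sets (map_law z) = sets (count_space {1..N})"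
  by (simp add: map_law_def sets_point_measure)

lemma emeasure_map_law: "j \<in> {1..N} \<Longrightarrow> emeasure (map_law z) {j} = ennreal (transition_row (snd z) j)"
  by (simp add: map_law_def emeasure_point_measure_finite)

sublocale maps: product_prob_space map_law UNIV
  by (simp add: product_prob_space_def product_sigma_finite_def product_prob_space_axioms_def
      prob_space_map_law prob_space_imp_sigma_finite)

lemma measurable_orbit_coordinate:
  "(\<lambda>\<omega>. random_map_orbit \<omega> n) \<in> measurable (PiM UNIV map_law) (count_space {1..N})"
proof (induction n)
  case 0
  show ?case
    using measurable_component_singleton[of "(0, 0)" UNIV map_law]
    by (simp add: measurable_cong_sets[OF refl sets_map_law])
next
  case (Suc n)
  have "(\<lambda>\<omega>. \<omega> (Suc n, i)) \<in> measurable (PiM UNIV map_law) (count_space {1..N})" for i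
    using measurable_component_singleton[of "(Suc n, i)" UNIV map_law]
    by (simp add: measurable_cong_sets[OF refl sets_map_law])
  then show ?case
    unfolding random_map_orbit.simps
    by (rule measurable_compose_countable'[OF _ Suc]) simp
qed

lemma measurable_random_map_orbit:
  "random_map_orbit \<in> measurable (PiM UNIV map_law) (full_shift_measure N)"
proof -
  have "(\<lambda>\<omega> n. random_map_orbit \<omega> n) \<in> measurable (PiM UNIV map_law) (full_shift_measure N)"
    unfolding full_shift_measure_def
    using measurable_space[OF measurable_orbit_coordinate]
    by (intro measurable_PiM_single' measurable_orbit_coordinate) auto
  then show ?thesis
    by simp
qed

lemma random_map_orbit_eq_iff:
  "(\<forall>i<n. random_map_orbit \<omega> i = w ! i) \<longleftrightarrow> (\<forall>i<n. \<omega> (i, (0 # w) ! i) = w ! i)"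
proof (induction n)
  case (Suc n)
  have "random_map_orbit \<omega> n = \<omega> (n, (0 # w) ! n)" if "\<forall>i<n. random_map_orbit \<omega> i = w ! i"
    using that by (cases n) auto
  then show ?case
    using Suc by (auto simp: less_Suc_eq)
qed simp

lemma prod_transition_row:
  assumes w: "w \<in> words {1..N} (Suc n)"
  shows "(\<Prod>i<Suc n. transition_row ((0 # w) ! i) (w ! i)) = \<pi> (w ! 0) * path_weight K w"
proof -
  have "w ! i \<in> {1..N}" if "i < Suc n" for i
    using w that by (rule nth_words)
  then show ?thesis
    by (simp add: prod.lessThan_Suc_shift transition_row_def path_weight_eq[OF length_words[OF w]]
        del: prod.lessThan_Suc)
qed

lemma emeasure_orbit_prefix:
  assumes w: "w \<in> words {1..N} (Suc n)"
  shows "emeasure (PiM UNIV map_law)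
      {\<omega> \<in> space (PiM UNIV map_law). \<forall>i<Suc n. random_map_orbit \<omega> i = w ! i}
    = ennreal (\<pi> (w ! 0) * path_weight K w)"
proof -
  let ?J = "(\<lambda>i. (i, (0 # w) ! i)) ` {..<Suc n}"
  have w_mem: "w ! i \<in> {1..N}" if "i < Suc n" for i
    using w that by (rule nth_words)
  have "emeasure (PiM UNIV map_law)
        {\<omega> \<in> space (PiM UNIV map_law). \<forall>i<Suc n. random_map_orbit \<omega> i = w ! i}
      = emeasure (PiM UNIV map_law) {\<omega> \<in> space (PiM UNIV map_law). \<forall>z\<in>?J. \<omega> z \<in> {w ! fst z}}"
    by (intro arg_cong[where f = "emeasure _"]) (auto simp: random_map_orbit_eq_iff)
  also have "\<dots> = (\<Prod>z\<in>?J. emeasure (map_law z) {w ! fst z})"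
    using w_mem by (intro maps.emeasure_PiM_Collect) auto
  also have "\<dots> = (\<Prod>i<Suc n. emeasure (map_law (i, (0 # w) ! i)) {w ! i})"
    by (subst prod.reindex) (simp_all add: inj_on_def del: prod.lessThan_Suc)
  also have "\<dots> = (\<Prod>i<Suc n. ennreal (transition_row ((0 # w) ! i) (w ! i)))"
    using w_mem by (intro prod.cong refl) (simp only: emeasure_map_law snd_conv lessThan_iff)
  also have "\<dots> = ennreal (\<Prod>i<Suc n. transition_row ((0 # w) ! i) (w ! i))"
    using w_mem by (intro prod_ennreal transition_row_nonneg) auto
  finally show ?thesis
    by (simp only: prod_transition_row[OF w])
qed

lemma markov_prob_chain: "markov_prob chain N \<pi> K"
proof -
  have "prob_space chain"
    unfolding chain_def by (rule maps.prob_space_distr[OF measurable_random_map_orbit])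
  then interpret full_shift_prob chain N
    by (simp add: full_shift_prob_def full_shift_prob_axioms_def chain_def)
  show ?thesis
  proof unfold_locales
    fix n w assume w: "w \<in> words {1..N} (Suc n)"
    have "emeasure chain (prefix_word (Suc n) -` {w} \<inter> space chain) = emeasure (PiM UNIV map_law)
        (random_map_orbit -` (prefix_word (Suc n) -` {w} \<inter> space chain) \<inter> space (PiM UNIV map_law))"
      using simple_functionD(2)[OF simple_function_prefix_word] sets_nu
      by (subst (1) chain_def) (intro emeasure_distr measurable_random_map_orbit, simp)
    also have "random_map_orbit -` (prefix_word (Suc n) -` {w} \<inter> space chain) \<inter> space (PiM UNIV map_law)
        = {\<omega> \<in> space (PiM UNIV map_law). \<forall>i<Suc n. random_map_orbit \<omega> i = w ! i}"
      using measurable_space[OF measurable_random_map_orbit]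
      by (auto simp: prefix_word_eq_iff[OF length_words[OF w]] chain_def)
    finally have "ennreal (point_mass chain (prefix_word (Suc n)) w)
        = ennreal (\<pi> (w ! 0) * path_weight K w)"
      by (simp only: emeasure_orbit_prefix[OF w] emeasure_eq_measure)
    moreover have "0 \<le> (\<Prod>i<Suc n. transition_row ((0 # w) ! i) (w ! i))"
      using nth_words[OF w] by (intro prod_nonneg ballI transition_row_nonneg) auto
    ultimately show "point_mass chain (prefix_word (Suc n)) w = \<pi> (w ! 0) * path_weight K w"
      by (simp only: prod_transition_row[OF w] ennreal_inj measure_nonneg)
  qed
qed

end

lemma (in full_shift_prob) point_mass_distr_shift:
  assumes w: "w \<in> words {1..N} n"
  shows "point_mass (distr \<nu> \<nu> shift) (prefix_word n) w
      = (\<Sum>a\<in>{1..N}. point_mass \<nu> (prefix_word (Suc n)) (a # w))"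
proof -
  have "point_mass (distr \<nu> \<nu> shift) (prefix_word n) w
      = prob (shift -` (prefix_word n -` {w} \<inter> space \<nu>) \<inter> space \<nu>)"
    using measure_distr[OF measurable_shift simple_functionD(2)[OF simple_function_prefix_word]] by simp
  also have "shift -` (prefix_word n -` {w} \<inter> space \<nu>) \<inter> space \<nu>
      = {x \<in> space \<nu>. prefix_word (Suc n) x \<in> (\<lambda>a. a # w) ` {1..N}}"
    using measurable_space[OF measurable_shift] by (auto simp: prefix_word_Suc space_nu)
  also have "prob \<dots> = (\<Sum>v\<in>(\<lambda>a. a # w) ` {1..N}. point_mass \<nu> (prefix_word (Suc n)) v)"
  proof -
    have "(\<lambda>a. a # w) ` {1..N} \<subseteq> words {1..N} (Suc n)"
      using w by (auto simp: words_def)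
    then show ?thesis
      by (simp add: prob_prefix_event Int_absorb2)
  qed
  also have "\<dots> = (\<Sum>a\<in>{1..N}. point_mass \<nu> (prefix_word (Suc n)) (a # w))"
    by (simp add: sum.reindex inj_on_def)
  finally show ?thesis .
qed

lemma (in markov_prob) shift_invariant:
  assumes stationary: "\<And>j. j \<in> {1..N} \<Longrightarrow> (\<Sum>i\<in>{1..N}. \<pi> i * K i j) = \<pi> j"
  shows "shift_invariant_prob \<nu> N"
proof -
  interpret shifted: full_shift_prob "distr \<nu> \<nu> shift" N
    by (rule full_shift_prob_distr_shift)
  have "distr \<nu> \<nu> shift = \<nu>"
  proof (rule full_shift_prob_eqI[OF shifted.full_shift_prob_axioms full_shift_prob_axioms])
    fix n w assume w: "w \<in> words {1..N} n"
    show "point_mass (distr \<nu> \<nu> shift) (prefix_word n) w = point_mass \<nu> (prefix_word n) w"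
    proof (cases n)
      case 0
      then have "prefix_word n -` {w} = UNIV"
        using w by (auto simp: prefix_word_def)
      then show ?thesis
        using shifted.prob_space prob_space by simp
    next
      case (Suc m)
      then have w': "w \<in> words {1..N} (Suc m)" "w ! 0 \<in> {1..N}"
        using w nth_words[OF w] by auto
      have "point_mass (distr \<nu> \<nu> shift) (prefix_word n) w = (\<Sum>a\<in>{1..N}. \<pi> a * path_weight K (a # w))"
        unfolding point_mass_distr_shift[OF w] using w
        by (intro sum.cong refl) (subst point_mass_prefix_word, auto simp: words_def)
      also have "\<dots> = (\<Sum>a\<in>{1..N}. \<pi> a * K a (w ! 0)) * path_weight K w"
        by (simp add: path_weight_Cons[OF length_words[OF w'(1)]] sum_distrib_right mult.assoc)
      also have "\<dots> = point_mass \<nu> (prefix_word n) w"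
        using point_mass_prefix_word[OF w'(1)] w'(2) Suc by (simp only: stationary)
      finally show ?thesis .
    qed
  qed
  then show ?thesis
    using measurable_shift by unfold_locales
qed

section \<open>The lower bound for the pressure\<close>

lemma (in full_shift_prob) integrable_edge_function:
  fixes g :: "nat \<Rightarrow> nat \<Rightarrow> real"
  shows "integrable \<nu> (\<lambda>x. g (x 0) (x 1))"
  using simple_function_coordinate
  by (intro integrable_simple_function simple_function_compose2[where h = g])

locale edge_markov_prob = stationary_edge_law "{1..N}" q +
  markov_prob \<nu> N "edge_source {1..N} q" "edge_kernel {1..N} q" for \<nu> and N :: nat and q
begin

sublocale shift_invariant_prob \<nu> N
  using edge_source_stationary by (rule shift_invariant)

lemma integral_edge_function:
  fixes g :: "nat \<Rightarrow> nat \<Rightarrow> real"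
  shows "(\<integral>x. g (x 0) (x 1) \<partial>\<nu>) = (\<Sum>i\<in>{1..N}. \<Sum>j\<in>{1..N}. q i j * g i j)"
proof -
  have "(\<integral>x. g (x 0) (x 1) \<partial>\<nu>) = (\<integral>x. g (prefix_word (Suc 1) x ! 0) (prefix_word (Suc 1) x ! 1) \<partial>\<nu>)"
    by (simp del: Suc_1)
  also have "\<dots> = (\<Sum>w\<in>words {1..N} (Suc 1). \<pi> (w ! 0) * path_weight K w * g (w ! 0) (w ! 1))"
    by (subst integral_simple_function[OF simple_prefix_word])
      (simp add: point_mass_prefix_word del: Suc_1)
  also have "\<dots> = (\<Sum>i\<in>{1..N}. \<Sum>j\<in>{1..N}. \<pi> i * K i j * g i j)"
    by (simp add: One_nat_def sum_words_Suc[of _ _ "Suc 0"] sum_words_1 path_weight_def)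
  also have "\<dots> = (\<Sum>i\<in>{1..N}. \<Sum>j\<in>{1..N}. q i j * g i j)"
    by (intro sum.cong refl) (simp only: edge_source_mult_kernel)
  finally show ?thesis .
qed

lemma AE_in_shift_space:
  assumes supp: "\<And>i j. i \<in> {1..N} \<Longrightarrow> j \<in> {1..N} \<Longrightarrow> B i j \<noteq> 1 \<Longrightarrow> q i j = 0"
  shows "AE x in \<nu>. x \<in> shift_space N B"
proof -
  have "(\<integral>x. of_bool (B (x 0) (x 1) \<noteq> 1) \<partial>\<nu>) = (0::real)"
    unfolding integral_edge_function[of "\<lambda>i j. of_bool (B i j \<noteq> 1)"]
    using supp by (intro sum.neutral ballI) auto
  then have "AE x in \<nu>. of_bool (B (x 0) (x 1) \<noteq> 1) = (0::real)"
    using integral_nonneg_eq_0_iff_AE[OF integrable_edge_function[of "\<lambda>i j. of_bool (B i j \<noteq> 1)"]]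
    by simp
  then have "AE x in \<nu>. B (x 0) (x 1) = 1"
    by eventually_elim (simp split: if_splits)
  then have "AE x in \<nu>. B (x i) (x (Suc i)) = 1" for i
    using AE_iterate[of "\<lambda>x. B (x 0) (x 1) = 1" i] by (simp add: funpow_shift One_nat_def)
  then have "AE x in \<nu>. \<forall>i. B (x i) (x (Suc i)) = 1"
    by (simp add: AE_all_countable)
  then show ?thesis
    using AE_space by eventually_elim (simp add: shift_space_def space_nu)
qed

lemma shannon_entropy_prefix_word:
  "shannon_entropy (prefix_word (Suc n))
      = (\<integral>x. - ln (\<pi> (x 0)) \<partial>\<nu>) + real n * (\<integral>x. - ln (K (x 0) (x 1)) \<partial>\<nu>)"
proof -
  let ?p = "\<lambda>w. \<pi> (w ! 0) * path_weight K w"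
  let ?info = "\<lambda>w. - ln (\<pi> (w ! 0)) + (\<Sum>i<n. - ln (K (w ! i) (w ! Suc i)))"
  have int: "integrable \<nu> (\<lambda>x. - ln (K (x 0) (x 1)))" "integrable \<nu> (\<lambda>x. - ln (\<pi> (x 0)))"
    by (rule integrable_edge_function[of "\<lambda>i j. - ln (K i j)"],
        rule integrable_edge_function[of "\<lambda>i j. - ln (\<pi> i)"])
  have "- ?p w * ln (?p w) = ?p w * ?info w" if w: "w \<in> words {1..N} (Suc n)" for w
    using ln_path_weight[OF length_words[OF w], of K]
    by (cases "?p w = 0") (auto simp: ln_mult sum_negf algebra_simps)
  then have "shannon_entropy (prefix_word (Suc n)) = (\<Sum>w\<in>words {1..N} (Suc n). ?p w * ?info w)"
    by (simp add: shannon_entropy_eq_sum[OF simple_prefix_word] point_mass_prefix_word)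
  also have "\<dots> = (\<integral>x. ?info (prefix_word (Suc n) x) \<partial>\<nu>)"
    by (subst integral_simple_function[OF simple_prefix_word]) (simp add: point_mass_prefix_word)
  also have "\<dots> = (\<integral>x. - ln (\<pi> (x 0)) + (\<Sum>i<n. - ln (K ((shift ^^ i) x 0) ((shift ^^ i) x 1))) \<partial>\<nu>)"
    by (simp add: funpow_shift One_nat_def)
  also have "\<dots> = (\<integral>x. - ln (\<pi> (x 0)) \<partial>\<nu>) + real n * (\<integral>x. - ln (K (x 0) (x 1)) \<partial>\<nu>)"
    unfolding integral_birkhoff_sum[OF int(1), symmetric]
    by (intro Bochner_Integration.integral_add integrable_birkhoff_sum int)
  finally show ?thesis .
qed

lemma edge_pressure_le_ks_entropy_plus_integral:
  "ereal (edge_pressure {1..N} W q) \<le> ks_entropy \<nu> shift + ereal (\<integral>x. ln (W (x 0) (x 1)) \<partial>\<nu>)"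
proof -
  define h0 h where "h0 = (\<integral>x. - ln (\<pi> (x 0)) \<partial>\<nu>)" and "h = (\<integral>x. - ln (K (x 0) (x 1)) \<partial>\<nu>)"
  have "(\<lambda>n. h + (h0 - h) / real (Suc n)) \<longlonglongrightarrow> h + 0"
    by (intro tendsto_intros LIMSEQ_Suc[OF lim_const_over_n])
  moreover have "shannon_entropy (prefix_word (Suc n)) / real (Suc n)
      = h + (h0 - h) / real (Suc n)" for n
    unfolding shannon_entropy_prefix_word h0_def[symmetric] h_def[symmetric] by (simp add: field_simps)
  ultimately have "ereal h \<le> ks_entropy \<nu> shift"
    by (intro letter_entropy_rate_le_ks_entropy) simp
  moreover have "edge_pressure {1..N} W q = h + (\<integral>x. ln (W (x 0) (x 1)) \<partial>\<nu>)"
    unfolding h_def integral_edge_function[of "\<lambda>i j. - ln (K i j)"]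
      integral_edge_function[of "\<lambda>i j. ln (W i j)"]
    by (simp add: edge_pressure_def sum.distrib[symmetric] right_diff_distrib)
  ultimately show ?thesis
    using add_right_mono[of "ereal h" "ks_entropy \<nu> shift" "ereal (\<integral>x. ln (W (x 0) (x 1)) \<partial>\<nu>)"] by simp
qed

end

lemma exists_edge_markov_prob:
  assumes "stationary_edge_law {1..N} q"
  shows "\<exists>\<nu>. edge_markov_prob \<nu> N q"
proof -
  interpret stationary_edge_law "{1..N}" q by fact
  interpret markov_chain N \<pi> K
    by unfold_locales
      (auto simp: edge_source_nonneg sum_edge_source edge_kernel_nonneg sum_edge_kernel
        row_stochastic_def)
  show ?thesis
    using markov_prob_chain assms by (auto simp: edge_markov_prob_def)
qed

lemma edge_pressure_le_pressure:
  assumes "stationary_edge_law {1..N} q"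
    and supp: "\<And>i j. i \<in> {1..N} \<Longrightarrow> j \<in> {1..N} \<Longrightarrow> B i j \<noteq> 1 \<Longrightarrow> q i j = 0"
  shows "ereal (edge_pressure {1..N} W q) \<le> pressure N (shift_space N B) (\<lambda>x. ln (W (x 0) (x 1)))"
proof -
  obtain \<nu> where "edge_markov_prob \<nu> N q"
    using exists_edge_markov_prob assms(1) by blast
  then interpret edge_markov_prob \<nu> N q .
  have "emeasure \<nu> (shift_space N B) = 1"
    using prob_eq_1[OF sets_shift_space] AE_in_shift_space[OF supp] by (simp add: emeasure_eq_measure)
  then have "\<nu> \<in> invariant_measures_on N (shift_space N B)"
    using shift_invariant_prob_axioms by (simp add: invariant_measures_on_iff)
  then show ?thesis
    unfolding pressure_def
    by (rule SUP_upper2) (rule edge_pressure_le_ks_entropy_plus_integral)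
qed

section \<open>The upper bound for the pressure\<close>

definition noisy_guess :: "real \<Rightarrow> 'b set \<Rightarrow> ('a \<Rightarrow> 'b) \<Rightarrow> 'b \<Rightarrow> 'a \<Rightarrow> real" where
  "noisy_guess \<delta> Q g S v = (if S = g v then 1 - \<delta> else \<delta> / real (card Q))"

lemma noisy_guess_pos: "0 < \<delta> \<Longrightarrow> \<delta> < 1 \<Longrightarrow> 0 < card Q \<Longrightarrow> 0 < noisy_guess \<delta> Q g S v"
  by (simp add: noisy_guess_def)

lemma sum_noisy_guess_le_1:
  assumes "0 < \<delta>" and "\<delta> < 1"
  shows "(\<Sum>S\<in>Q. noisy_guess \<delta> Q g S v) \<le> 1"
proof (cases "card Q = 0")
  case False
  then have Q: "finite Q"
    by (simp add: card_ge_0_finite)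
  have "(\<Sum>S\<in>Q. noisy_guess \<delta> Q g S v) \<le> (\<Sum>S\<in>Q. (if S = g v then 1 - \<delta> else 0) + \<delta> / real (card Q))"
    using assms by (intro sum_mono) (auto simp: noisy_guess_def)
  also have "\<dots> = (if g v \<in> Q then 1 - \<delta> else 0) + \<delta>"
    using False Q by (simp add: sum.distrib)
  also have "\<dots> \<le> 1"
    using assms by auto
  finally show ?thesis .
qed (auto simp: card_eq_0_iff)

lemma neg_ln_noisy_guess_le:
  assumes "0 < \<delta>" and "\<delta> < 1"
  shows "- ln (noisy_guess \<delta> Q g S v) \<le> - ln (1 - \<delta>) + \<bar>ln (\<delta> / real (card Q))\<bar> * of_bool (g v \<noteq> S)"
proof -
  have "ln (1 - \<delta>) \<le> 0"
    using assms by simp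
  then show ?thesis
    using abs_ge_minus_self[of "ln (\<delta> / real (card Q))"]
    by (simp add: noisy_guess_def del: abs_ge_minus_self)
qed

lemma (in full_shift_prob) integral_neg_ln_noisy_guess_le:
  assumes "finite_partition \<nu> Q" and \<delta>: "0 < \<delta>" "\<delta> < 1"
  shows "(\<integral>x. - ln (noisy_guess \<delta> Q g (cell Q x) (prefix_word k x)) \<partial>\<nu>)
    \<le> - ln (1 - \<delta>) + \<bar>ln (\<delta> / real (card Q))\<bar> * prob {x \<in> space \<nu>. g (prefix_word k x) \<noteq> cell Q x}"
proof -
  interpret finite_partition \<nu> Q by fact
  let ?b = "\<bar>ln (\<delta> / real (card Q))\<bar>"
  let ?miss = "\<lambda>x. of_bool (g (prefix_word k x) \<noteq> cell Q x) :: real"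
  let ?cost = "\<lambda>x. - ln (noisy_guess \<delta> Q g (cell Q x) (prefix_word k x))"
  have int: "integrable \<nu> ?cost" "integrable \<nu> ?miss"
    by (intro integrable_simple_function
        simple_function_compose2[OF simple_function_cell simple_function_prefix_word])+
  have "(\<integral>x. ?cost x \<partial>\<nu>) \<le> (\<integral>x. - ln (1 - \<delta>) + ?b * ?miss x \<partial>\<nu>)"
    using int by (intro integral_mono neg_ln_noisy_guess_le \<delta>) simp_all
  also have "\<dots> = - ln (1 - \<delta>) + ?b * (\<integral>x. ?miss x \<partial>\<nu>)"
    using int(2) by (simp add: prob_space)
  also have "?miss = indicator {x. g (prefix_word k x) \<noteq> cell Q x}"
    by (auto simp: indicator_def)
  also have "(\<integral>x. indicator {x. g (prefix_word k x) \<noteq> cell Q x} x \<partial>\<nu>)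
      = prob {x \<in> space \<nu>. g (prefix_word k x) \<noteq> cell Q x}"
    by (simp add: Int_def conj_commute)
  finally show ?thesis .
qed

lemma (in full_shift_prob) exists_guessing_kernel:
  fixes \<eta> :: real
  assumes Q: "finite_partition \<nu> Q" and \<eta>: "0 < \<eta>"
  shows "\<exists>k \<kappa>. (\<forall>S v. 0 < \<kappa> S v) \<and> (\<forall>v. (\<Sum>S\<in>Q. \<kappa> S v) \<le> 1) \<and>
    (\<integral>x. - ln (\<kappa> (cell Q x) (prefix_word k x)) \<partial>\<nu>) \<le> \<eta>"
proof -
  interpret finite_partition \<nu> Q by fact
  define \<delta> where "\<delta> = 1 - exp (- \<eta> / 2)"
  have \<delta>: "0 < \<delta>" "\<delta> < 1" "- ln (1 - \<delta>) = \<eta> / 2"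
    using \<eta> by (auto simp: \<delta>_def)
  define b where "b = \<bar>ln (\<delta> / real (card Q))\<bar>"
  have "0 < \<eta> / (2 * (b + 1))"
    using \<eta> by (auto simp: b_def)
  then obtain k g where kg: "prob {x \<in> space \<nu>. g (prefix_word k x) \<noteq> cell Q x} < \<eta> / (2 * (b + 1))"
    using partition_approximation[OF Q] by blast
  have "(\<integral>x. - ln (noisy_guess \<delta> Q g (cell Q x) (prefix_word k x)) \<partial>\<nu>)
      \<le> \<eta> / 2 + b * prob {x \<in> space \<nu>. g (prefix_word k x) \<noteq> cell Q x}"
    using integral_neg_ln_noisy_guess_le[OF Q \<delta>(1,2)] by (simp only: \<delta>(3) b_def)
  also have "\<dots> \<le> \<eta> / 2 + b * (\<eta> / (2 * (b + 1)))"
    using kg by (intro add_left_mono mult_left_mono) (auto simp: b_def)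
  also have "\<dots> \<le> \<eta>"
    using \<eta> by (simp add: b_def field_simps)
  finally have "(\<integral>x. - ln (noisy_guess \<delta> Q g (cell Q x) (prefix_word k x)) \<partial>\<nu>) \<le> \<eta>" .
  moreover have "Q \<noteq> {}"
    using Union_Q not_empty by auto
  then have "0 < card Q"
    using finite_Q by (simp add: card_gt_0_iff)
  ultimately show ?thesis
    using noisy_guess_pos[OF \<delta>(1,2)] sum_noisy_guess_le_1[OF \<delta>(1,2)]
    by (intro exI[of _ k] exI[of _ "noisy_guess \<delta> Q g"]) auto
qed

text \<open>The law that draws the letters proportionally to their weight and then, independently for
  each \<open>i\<close>, the \<open>i\<close>-th symbol of the itinerary from \<open>\<kappa>\<close>, given the window of \<open>k\<close> letters at \<open>i\<close>.\<close>

definition (in nonneg_matrix) coupled_law ::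
    "('b \<Rightarrow> 'a list \<Rightarrow> real) \<Rightarrow> nat \<Rightarrow> nat \<Rightarrow> 'b list \<times> 'a list \<Rightarrow> real" where
  "coupled_law \<kappa> n k z
    = path_weight W (snd z) / Z (n + k) * (\<Prod>i<n. \<kappa> (fst z ! i) (take k (drop i (snd z))))"

lemma (in nonneg_matrix) coupled_law_nonneg:
  assumes "\<And>S v. 0 < \<kappa> S v" and "z \<in> words Q n \<times> words S (Suc (n + k))"
  shows "0 \<le> coupled_law \<kappa> n k z"
  unfolding coupled_law_def using assms
  by (intro mult_nonneg_nonneg divide_nonneg_nonneg partition_function_nonneg prod_nonneg)
    (auto intro: path_weight_nonneg less_imp_le)

lemma (in nonneg_matrix) sum_coupled_law_le_1:
  assumes \<kappa>_pos: "\<And>S v. 0 < \<kappa> S v" and \<kappa>_sum: "\<And>v. (\<Sum>S\<in>Q. \<kappa> S v) \<le> 1"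
  shows "sum (coupled_law \<kappa> n k) (words Q n \<times> words S (Suc (n + k))) \<le> 1"
proof -
  let ?I = "words S (Suc (n + k))"
  have "sum (coupled_law \<kappa> n k) (words Q n \<times> ?I) = (\<Sum>w\<in>?I. \<Sum>f\<in>words Q n. coupled_law \<kappa> n k (f, w))"
    unfolding sum.cartesian_product' by (rule sum.swap)
  also have "\<dots> = (\<Sum>w\<in>?I. path_weight W w / Z (n + k) * (\<Prod>i<n. \<Sum>S\<in>Q. \<kappa> S (take k (drop i w))))"
    by (simp only: coupled_law_def fst_conv snd_conv sum_distrib_left[symmetric]
        sum_words_prod[of "\<lambda>i S. \<kappa> S (take k (drop i _))" n Q])
  also have "\<dots> \<le> (\<Sum>w\<in>?I. path_weight W w / Z (n + k) * 1)"
    by (intro sum_mono mult_left_mono prod_le_1 conjI \<kappa>_sum divide_nonneg_nonneg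
        partition_function_nonneg path_weight_nonneg sum_nonneg less_imp_le[OF \<kappa>_pos])
  also have "\<dots> \<le> 1"
    by (simp add: sum_divide_distrib[symmetric] partition_function_def[symmetric])
  finally show ?thesis .
qed

locale weighted_subshift = nonneg_matrix "{1..N}" W for N :: nat and W +
  fixes B :: "nat \<Rightarrow> nat \<Rightarrow> real"
  assumes W_pos_iff: "\<And>i j. i \<in> {1..N} \<Longrightarrow> j \<in> {1..N} \<Longrightarrow> 0 < W i j \<longleftrightarrow> B i j = 1"
begin

abbreviation "subshift \<equiv> shift_space N B"
abbreviation "potential \<equiv> \<lambda>x. ln (W (x 0) (x (1::nat)))"

lemma path_weight_prefix_word_pos:
  assumes "x \<in> subshift"
  shows "0 < path_weight W (prefix_word (Suc n) x)"
  using assms by (auto simp: path_weight_eq[of _ n] W_pos_iff shift_space_def intro!: prod_pos)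

lemma ln_path_weight_prefix_word:
  assumes "x \<in> subshift"
  shows "ln (path_weight W (prefix_word (Suc n) x)) = (\<Sum>i<n. potential ((shift ^^ i) x))"
  using path_weight_prefix_word_pos[OF assms, of n]
  by (subst ln_path_weight[of _ n]) (auto simp: funpow_shift One_nat_def)

lemma partition_function_pos_of_mem:
  assumes "x \<in> subshift"
  shows "0 < Z n"
proof -
  have "prefix_word (Suc n) x \<in> words {1..N} (Suc n)"
    using assms by (auto simp: words_def prefix_word_def shift_space_def)
  then show ?thesis
    using path_weight_prefix_word_pos[OF assms] partition_function_pos_iff by blast
qed

lemma
  fixes x :: "nat \<Rightarrow> nat" and Q n k \<kappa>
  defines "z \<equiv> (itinerary shift Q n x, prefix_word (Suc (n + k)) x)"
  assumes x: "x \<in> subshift" and \<kappa>_pos: "\<And>S v. 0 < \<kappa> S v"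
  shows coupled_law_pos: "0 < coupled_law \<kappa> n k z"
    and neg_ln_coupled_law: "- ln (coupled_law \<kappa> n k z)
        = ln (Z (n + k)) - (\<Sum>i<n + k. potential ((shift ^^ i) x))
      + (\<Sum>i<n. - ln (\<kappa> (cell Q ((shift ^^ i) x)) (prefix_word k ((shift ^^ i) x))))"
proof -
  let ?guess = "\<Prod>i<n. \<kappa> (cell Q ((shift ^^ i) x)) (prefix_word k ((shift ^^ i) x))"
  have law: "coupled_law \<kappa> n k z = path_weight W (prefix_word (Suc (n + k)) x) / Z (n + k) * ?guess"
    by (simp add: z_def coupled_law_def window_prefix_word itinerary_def)
  have pos: "0 < path_weight W (prefix_word (Suc (n + k)) x)" "0 < Z (n + k)" "0 < ?guess"
    using x \<kappa>_pos by (auto intro: path_weight_prefix_word_pos partition_function_pos_of_mem prod_pos)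
  then show "0 < coupled_law \<kappa> n k z"
    unfolding law by simp
  have "ln ?guess = (\<Sum>i<n. ln (\<kappa> (cell Q ((shift ^^ i) x)) (prefix_word k ((shift ^^ i) x))))"
    using less_imp_neq[OF \<kappa>_pos, symmetric] by (intro ln_prod) simp_all
  then show "- ln (coupled_law \<kappa> n k z) = ln (Z (n + k)) - (\<Sum>i<n + k. potential ((shift ^^ i) x))
      + (\<Sum>i<n. - ln (\<kappa> (cell Q ((shift ^^ i) x)) (prefix_word k ((shift ^^ i) x))))"
    unfolding law ln_path_weight_prefix_word[OF x, symmetric] sum_negf
    using pos by (simp only: ln_mult_pos ln_divide_pos divide_pos_pos)
qed

lemma partition_entropy_le_integral_coupled_law:
  assumes \<nu>: "\<nu> \<in> invariant_measures_on N subshift" and Q: "finite_partition \<nu> Q"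
    and \<kappa>_pos: "\<And>S v. 0 < \<kappa> S v" and \<kappa>_sum: "\<And>v. (\<Sum>S\<in>Q. \<kappa> S v) \<le> 1"
  shows "partition_entropy \<nu> (iterated_join \<nu> shift Q n)
    \<le> (\<integral>x. - ln (coupled_law \<kappa> n k (itinerary shift Q n x, prefix_word (Suc (n + k)) x)) \<partial>\<nu>)"
proof -
  interpret shift_invariant_prob \<nu> N
    using \<nu> by (simp add: invariant_measures_on_iff)
  interpret finite_partition \<nu> Q by fact
  interpret preserved_partition \<nu> shift Q ..
  let ?z = "\<lambda>x. (itinerary shift Q n x, prefix_word (Suc (n + k)) x)"
  let ?I = "words Q n \<times> words {1..N} (Suc (n + k))"
  have "partition_entropy \<nu> (iterated_join \<nu> shift Q n) \<le> shannon_entropy ?z"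
    unfolding partition_entropy_iterated_join
    by (intro shannon_entropy_Pair_ge simple_function_itinerary simple_function_prefix_word)
  also have "\<dots> \<le> (\<integral>x. - ln (coupled_law \<kappa> n k (?z x)) \<partial>\<nu>)"
  proof (rule shannon_entropy_le_integral)
    show "finite ?I" "?z \<in> space \<nu> \<rightarrow> ?I"
      using itinerary_in_words[of n] prefix_word_in_words[of "Suc (n + k)"] by (auto simp: finite_Q)
    show "AE x in \<nu>. 0 < coupled_law \<kappa> n k (?z x)"
      using invariant_measures_on_AE_in[OF \<nu>] by eventually_elim (intro coupled_law_pos \<kappa>_pos)
  qed (intro simple_function_Pair simple_function_itinerary simple_function_prefix_word
      coupled_law_nonneg sum_coupled_law_le_1 \<kappa>_pos \<kappa>_sum | assumption)+
  finally show ?thesis .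
qed

lemma integral_neg_ln_coupled_law:
  assumes \<nu>: "\<nu> \<in> invariant_measures_on N subshift" and Q: "finite_partition \<nu> Q"
    and \<kappa>_pos: "\<And>S v. 0 < \<kappa> S v"
  shows "(\<integral>x. - ln (coupled_law \<kappa> n k (itinerary shift Q n x, prefix_word (Suc (n + k)) x)) \<partial>\<nu>)
    = ln (Z (n + k)) - real (n + k) * (\<integral>x. potential x \<partial>\<nu>)
      + real n * (\<integral>x. - ln (\<kappa> (cell Q x) (prefix_word k x)) \<partial>\<nu>)"
proof -
  interpret shift_invariant_prob \<nu> N
    using \<nu> by (simp add: invariant_measures_on_iff)
  interpret finite_partition \<nu> Q by fact
  interpret preserved_partition \<nu> shift Q ..
  let ?c = "\<lambda>x. - ln (\<kappa> (cell Q x) (prefix_word k x))"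
  let ?z = "\<lambda>x. (itinerary shift Q n x, prefix_word (Suc (n + k)) x)"
  have int: "integrable \<nu> potential" "integrable \<nu> ?c"
    by (rule integrable_edge_function, intro integrable_simple_function
        simple_function_compose2[OF simple_function_cell simple_function_prefix_word])
  have "(\<integral>x. - ln (coupled_law \<kappa> n k (?z x)) \<partial>\<nu>)
      = (\<integral>x. ln (Z (n + k)) - (\<Sum>i<n + k. potential ((shift ^^ i) x)) + (\<Sum>i<n. ?c ((shift ^^ i) x)) \<partial>\<nu>)"
  proof (rule integral_cong_AE)
    have "simple_function \<nu> ?z"
      by (intro simple_function_Pair simple_function_itinerary simple_function_prefix_word)
    from simple_function_compose1[OF this, of "\<lambda>z. - ln (coupled_law \<kappa> n k z)"]
    show "(\<lambda>x. - ln (coupled_law \<kappa> n k (?z x))) \<in> borel_measurable \<nu>"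
      by (rule borel_measurable_simple_function)
    show "AE x in \<nu>. - ln (coupled_law \<kappa> n k (?z x))
        = ln (Z (n + k)) - (\<Sum>i<n + k. potential ((shift ^^ i) x)) + (\<Sum>i<n. ?c ((shift ^^ i) x))"
      using invariant_measures_on_AE_in[OF \<nu>] by eventually_elim (intro neg_ln_coupled_law \<kappa>_pos)
  qed (intro borel_measurable_integrable Bochner_Integration.integrable_add
      Bochner_Integration.integrable_diff integrable_birkhoff_sum int integrable_const)
  then show ?thesis
    unfolding integral_birkhoff_sum[OF int(1), symmetric] integral_birkhoff_sum[OF int(2), symmetric]
    using integrable_birkhoff_sum[OF int(1)] integrable_birkhoff_sum[OF int(2)]
    by (simp add: Bochner_Integration.integral_add Bochner_Integration.integral_diff prob_space)
qed

lemma partition_entropy_rate_le: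
  assumes \<nu>: "\<nu> \<in> invariant_measures_on N subshift" and Q: "finite_partition \<nu> Q" and \<eta>: "0 < \<eta>"
  shows "\<exists>C. \<forall>n>0.
    partition_entropy \<nu> (iterated_join \<nu> shift Q n) / real n + (\<integral>x. potential x \<partial>\<nu>) - \<eta> + C / real n
    \<le> ln (Z n) / real n"
proof -
  interpret shift_invariant_prob \<nu> N
    using \<nu> by (simp add: invariant_measures_on_iff)
  define I where "I = (\<integral>x. potential x \<partial>\<nu>)"
  obtain k \<kappa> where \<kappa>: "\<And>S v. 0 < \<kappa> S v" "\<And>v. (\<Sum>S\<in>Q. \<kappa> S v) \<le> 1"
    and cost: "(\<integral>x. - ln (\<kappa> (cell Q x) (prefix_word k x)) \<partial>\<nu>) \<le> \<eta>"
    using exists_guessing_kernel[OF Q \<eta>] by auto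
  obtain R where R: "0 < R" "\<And>i. i \<in> {1..N} \<Longrightarrow> (\<Sum>j\<in>{1..N}. W i j) \<le> R"
    using exists_row_sum_bound by auto
  have "subshift \<noteq> {}"
    using \<nu> by force
  then have Z_pos: "0 < Z m" for m
    using partition_function_pos_of_mem by blast
  have "partition_entropy \<nu> (iterated_join \<nu> shift Q n) / real n + I - \<eta> + real k * (I - ln R) / real n
      \<le> ln (Z n) / real n" if n: "0 < n" for n
  proof -
    have "partition_entropy \<nu> (iterated_join \<nu> shift Q n)
        \<le> ln (Z (n + k)) - real (n + k) * I + real n * (\<integral>x. - ln (\<kappa> (cell Q x) (prefix_word k x)) \<partial>\<nu>)"
      using partition_entropy_le_integral_coupled_law[OF \<nu> Q \<kappa>]
      unfolding I_def integral_neg_ln_coupled_law[OF \<nu> Q \<kappa>(1)] .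
    also have "\<dots> \<le> ln (Z (n + k)) - real (n + k) * I + real n * \<eta>"
      using cost by (intro add_left_mono mult_left_mono) auto
    also have "ln (Z (n + k)) \<le> ln (R ^ k * Z n)"
      using partition_function_add_le[of R n k] R Z_pos by (intro ln_mono) auto
    also have "\<dots> = real k * ln R + ln (Z n)"
      using R(1) Z_pos[of n] by (simp add: ln_mult ln_realpow)
    finally have "partition_entropy \<nu> (iterated_join \<nu> shift Q n) / real n
        \<le> (real k * ln R + ln (Z n) - real (n + k) * I + real n * \<eta>) / real n"
      by (intro divide_right_mono) auto
    then show ?thesis
      using n by (simp add: add_divide_distrib diff_divide_distrib distrib_right right_diff_distrib)
  qed
  then show ?thesis
    unfolding I_def by blast
qed

lemma entropy_rate_plus_integral_le_liminf:
  assumes \<nu>: "\<nu> \<in> invariant_measures_on N subshift" and Q: "finite_partition \<nu> Q"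
  shows "ereal (lim (\<lambda>n. partition_entropy \<nu> (iterated_join \<nu> shift Q n) / real n)
      + (\<integral>x. potential x \<partial>\<nu>))
    \<le> liminf (\<lambda>n. ereal (ln (Z n) / real n))"
proof -
  interpret shift_invariant_prob \<nu> N
    using \<nu> by (simp add: invariant_measures_on_iff)
  interpret finite_partition \<nu> Q by fact
  interpret preserved_partition \<nu> shift Q ..
  define h where "h = lim (\<lambda>n. partition_entropy \<nu> (iterated_join \<nu> shift Q n) / real n)"
  define I where "I = (\<integral>x. potential x \<partial>\<nu>)"
  have "ereal (h + I) \<le> liminf (\<lambda>n. ereal (ln (Z n) / real n)) + ereal \<eta>" if \<eta>: "0 < \<eta>" for \<eta>
  proof -
    obtain C where C: "\<And>n. 0 < n \<Longrightarrow>
        partition_entropy \<nu> (iterated_join \<nu> shift Q n) / real n + I - \<eta> + C / real n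
          \<le> ln (Z n) / real n"
      using partition_entropy_rate_le[OF \<nu> Q \<eta>] unfolding I_def by blast
    let ?l = "\<lambda>n. ereal (partition_entropy \<nu> (iterated_join \<nu> shift Q n) / real n + I - \<eta> + C / real n)"
    have "?l \<longlonglongrightarrow> ereal (h + I - \<eta> + 0)"
      unfolding h_def
      by (intro tendsto_intros tendsto_ereal partition_entropy_rate_LIMSEQ lim_const_over_n)
    then have "ereal (h + I - \<eta>) = liminf ?l"
      by (intro lim_imp_Liminf[symmetric]) simp_all
    also have "\<dots> \<le> liminf (\<lambda>n. ereal (ln (Z n) / real n))"
      using eventually_gt_at_top[of 0] by (intro Liminf_mono, eventually_elim) (simp add: C)
    finally have "ereal (h + I - \<eta>) + ereal \<eta> \<le> liminf (\<lambda>n. ereal (ln (Z n) / real n)) + ereal \<eta>"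
      by (rule add_right_mono)
    then show ?thesis
      by simp
  qed
  then show ?thesis
    unfolding h_def[symmetric] I_def[symmetric] by (rule ereal_le_epsilon2)
qed

lemma pressure_le_liminf: "pressure N subshift potential \<le> liminf (\<lambda>n. ereal (ln (Z n) / real n))"
  unfolding pressure_def
proof (rule SUP_least)
  fix \<nu> assume \<nu>: "\<nu> \<in> invariant_measures_on N subshift"
  have "ks_entropy \<nu> shift \<le> liminf (\<lambda>n. ereal (ln (Z n) / real n)) - ereal (\<integral>x. potential x \<partial>\<nu>)"
    unfolding ks_entropy_def
  proof (rule SUP_least)
    fix Q assume "Q \<in> finite_measurable_partitions \<nu>"
    then show "ereal (lim (\<lambda>n. partition_entropy \<nu> (iterated_join \<nu> shift Q n) / real n))
        \<le> liminf (\<lambda>n. ereal (ln (Z n) / real n)) - ereal (\<integral>x. potential x \<partial>\<nu>)"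
      using entropy_rate_plus_integral_le_liminf[OF \<nu> finite_partition.intro]
      by (simp add: ereal_le_minus)
  qed
  then show "ks_entropy \<nu> shift + ereal (\<integral>x. potential x \<partial>\<nu>) \<le> liminf (\<lambda>n. ereal (ln (Z n) / real n))"
    by (simp add: ereal_le_minus)
qed

end

section \<open>The variational principle\<close>

definition extended_ln :: "real \<Rightarrow> ereal" where
  "extended_ln x = (if x = 0 then - \<infinity> else ereal (ln x))"

lemma extended_ln_0 [simp]: "extended_ln 0 = - \<infinity>"
  by (simp add: extended_ln_def)

context weighted_subshift
begin

lemma ln_partition_function_tendsto_pressure:
  assumes pos: "\<And>n. 0 < Z n"
  shows "(\<lambda>n. ereal (ln (Z n) / real n)) \<longlonglongrightarrow> pressure N subshift potential"
proof -
  interpret nonvanishing_matrix "{1..N}" W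
    using pos by unfold_locales
  let ?u = "\<lambda>n. ereal (ln (Z n) / real n)"
  obtain q where q: "stationary_edge_law {1..N} q"
    and supp: "\<forall>i\<in>{1..N}. \<forall>j\<in>{1..N}. W i j = 0 \<longrightarrow> q i j = 0"
    and limsup: "limsup (\<lambda>n. ?u (Suc n)) \<le> ereal (edge_pressure {1..N} W q)"
    using exists_optimal_edge_law by blast
  have "q i j = 0" if "i \<in> {1..N}" "j \<in> {1..N}" "B i j \<noteq> 1" for i j
    using that supp W_pos_iff[of i j] W_nonneg[of i j] by force
  then have "ereal (edge_pressure {1..N} W q) \<le> pressure N subshift potential"
    by (rule edge_pressure_le_pressure[OF q])
  with limsup have "limsup (\<lambda>n. ?u (Suc n)) \<le> pressure N subshift potential"
    by (rule order_trans)
  moreover have "pressure N subshift potential \<le> liminf (\<lambda>n. ?u (Suc n))"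
    using pressure_le_liminf liminf_subseq_mono[of Suc ?u]
    by (auto simp: comp_def strict_mono_Suc_iff intro: order_trans)
  moreover have "liminf (\<lambda>n. ?u (Suc n)) \<le> limsup (\<lambda>n. ?u (Suc n))"
    by (rule Liminf_le_Limsup) simp
  ultimately have "(\<lambda>n. ?u (Suc n)) \<longlonglongrightarrow> pressure N subshift potential"
    by (intro Liminf_eq_Limsup) auto
  then show ?thesis
    by (rule LIMSEQ_imp_Suc)
qed

theorem variational_principle:
  "(\<lambda>n. extended_ln (Z n) / ereal (real n)) \<longlonglongrightarrow> pressure N subshift potential"
proof (cases "\<forall>n. 0 < Z n")
  case True
  from eventually_gt_at_top[of 0]
  have "\<forall>\<^sub>F n in sequentially. ereal (ln (Z n) / real n) = extended_ln (Z n) / ereal (real n)"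
  proof eventually_elim
    case (elim n)
    then show ?case
      using spec[OF True, of n] by (simp add: extended_ln_def)
  qed
  then show ?thesis
    using True ln_partition_function_tendsto_pressure by (blast intro: Lim_transform_eventually)
next
  case False
  then obtain k where k: "Z k = 0"
    using partition_function_nonneg by (metis less_eq_real_def)
  have "subshift = {}"
    using partition_function_pos_of_mem[of _ k] k by force
  moreover have "\<forall>\<^sub>F n in sequentially. extended_ln (Z n) / ereal (real n) = - \<infinity>"
    using eventually_ge_at_top[of k] eventually_gt_at_top[of 0]
    by eventually_elim (simp add: partition_function_eq_0_mono[OF k])
  ultimately show ?thesis
    by (simp add: pressure_empty tendsto_eventually)
qed

lemma pressure_stochastic:
  assumes N: "0 < N" and stochastic: "\<And>i. i \<in> {1..N} \<Longrightarrow> (\<Sum>j\<in>{1..N}. W i j) = 1"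
  shows "pressure N subshift potential = 0"
proof (rule LIMSEQ_unique[OF variational_principle])
  have "Z n = real N" for n
    using partition_function_stochastic[of "{1..N}" W n, OF stochastic] by simp
  then have Z: "extended_ln (Z n) = ereal (ln (real N))" for n
    using N by (simp add: extended_ln_def)
  have "(\<lambda>n. ereal (ln (real N) / real n)) \<longlonglongrightarrow> ereal 0"
    by (intro tendsto_ereal lim_const_over_n)
  moreover have "\<forall>\<^sub>F n in sequentially. ereal (ln (real N) / real n)
      = extended_ln (Z n) / ereal (real n)"
    using eventually_gt_at_top[of 0]
    by eventually_elim (simp add: Z)
  ultimately show "(\<lambda>n. extended_ln (Z n) / ereal (real n)) \<longlonglongrightarrow> 0"
    unfolding zero_ereal_def by (rule Lim_transform_eventually)
qed

end

section \<open>Exponential growth rates\<close>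

lemma extended_ln_mono: "0 \<le> x \<Longrightarrow> x \<le> y \<Longrightarrow> extended_ln x \<le> extended_ln y"
  by (auto simp: extended_ln_def)

lemma growth_rate_cmult:
  assumes c: "0 < c" and f: "(\<lambda>n. extended_ln (f n) / ereal (real n)) \<longlonglongrightarrow> L"
  shows "(\<lambda>n. extended_ln (c * f n) / ereal (real n)) \<longlonglongrightarrow> L"
proof -
  have "(\<lambda>n. ereal (ln c / real n) + extended_ln (f n) / ereal (real n)) \<longlonglongrightarrow> ereal 0 + L"
    by (intro tendsto_add_ereal_general2 tendsto_ereal lim_const_over_n f) simp
  moreover have "\<forall>\<^sub>F n in sequentially.
      ereal (ln c / real n) + extended_ln (f n) / ereal (real n)
        = extended_ln (c * f n) / ereal (real n)"
    using eventually_gt_at_top[of 0]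
    by eventually_elim (use c in \<open>simp add: extended_ln_def ln_mult add_divide_distrib\<close>)
  ultimately show ?thesis
    by (auto intro: Lim_transform_eventually simp flip: zero_ereal_def)
qed

lemma growth_rate_Suc:
  assumes f: "(\<lambda>n. extended_ln (f n) / ereal (real n)) \<longlonglongrightarrow> L"
  shows "(\<lambda>n. extended_ln (f (Suc n)) / ereal (real n)) \<longlonglongrightarrow> L"
proof -
  have "(\<lambda>n. ereal (real (Suc n) / real n) * (extended_ln (f (Suc n)) / ereal (real (Suc n))))
      \<longlonglongrightarrow> ereal 1 * L"
    by (intro tendsto_mult_ereal tendsto_ereal LIMSEQ_Suc_n_over_n LIMSEQ_Suc[OF f]) auto
  moreover have "\<forall>\<^sub>F n in sequentially.
      ereal (real (Suc n) / real n) * (extended_ln (f (Suc n)) / ereal (real (Suc n)))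
      = extended_ln (f (Suc n)) / ereal (real n)"
    using eventually_gt_at_top[of 0]
    by eventually_elim (simp add: extended_ln_def del: of_nat_Suc)
  ultimately show ?thesis
    by (auto intro: Lim_transform_eventually simp flip: one_ereal_def)
qed

lemma growth_rate_comparable:
  assumes c: "0 < c" "\<And>n. c * f n \<le> g n" and C: "0 < C" "\<And>n. g n \<le> C * f n" and f_nonneg: "\<And>n. 0 \<le> f n"
    and f: "(\<lambda>n. extended_ln (f n) / ereal (real n)) \<longlonglongrightarrow> L"
  shows "(\<lambda>n. extended_ln (g n) / ereal (real n)) \<longlonglongrightarrow> L"
proof (rule tendsto_sandwich)
  have cf: "0 \<le> c * f n" for n
    using c(1) f_nonneg by simp
  then have g_nonneg: "0 \<le> g n" for n
    using c(2) by (rule order_trans)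
  show "\<forall>\<^sub>F n in sequentially. extended_ln (c * f n) / ereal (real n)
      \<le> extended_ln (g n) / ereal (real n)"
    using eventually_gt_at_top[of 0]
    by eventually_elim (simp add: ereal_divide_right_mono extended_ln_mono cf c(2))
  show "\<forall>\<^sub>F n in sequentially. extended_ln (g n) / ereal (real n)
      \<le> extended_ln (C * f n) / ereal (real n)"
    using eventually_gt_at_top[of 0]
    by eventually_elim (simp add: ereal_divide_right_mono extended_ln_mono g_nonneg C(2))
qed (intro growth_rate_cmult c(1) C(1) f)+

lemma escape_seq_eq: "escape_seq \<mu> W = - extended_ln (measure \<mu> W)"
  by (simp add: escape_seq_def extended_ln_def)

section \<open>Positivity of the stationary vector\<close>

lemma mat_pow_nonneg:
  assumes "\<And>i j. i \<in> {1..N} \<Longrightarrow> j \<in> {1..N} \<Longrightarrow> 0 \<le> M i j" and "j \<in> {1..N}"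
  shows "0 \<le> mat_pow N M n i j"
  using assms(2) by (induction n arbitrary: j) (auto intro!: sum_nonneg mult_nonneg_nonneg assms(1))

lemma mat_pow_pos_mono:
  assumes A: "\<And>i j. i \<in> {1..N} \<Longrightarrow> j \<in> {1..N} \<Longrightarrow> 0 \<le> A i j"
    and P: "\<And>i j. i \<in> {1..N} \<Longrightarrow> j \<in> {1..N} \<Longrightarrow> 0 \<le> P i j"
    and AP: "\<And>i j. i \<in> {1..N} \<Longrightarrow> j \<in> {1..N} \<Longrightarrow> 0 < A i j \<Longrightarrow> 0 < P i j"
    and "j \<in> {1..N}" and "0 < mat_pow N A n i j"
  shows "0 < mat_pow N P n i j"
  using assms(4,5)
proof (induction n arbitrary: j)
  case (Suc n)
  have "(\<Sum>k\<in>{1..N}. mat_pow N A n i k * A k j) \<noteq> 0"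
    using Suc.prems(2) by simp
  then obtain k where k: "k \<in> {1..N}" "mat_pow N A n i k \<noteq> 0" "A k j \<noteq> 0"
    by (rule sum.not_neutral_contains_not_neutral) auto
  have "0 < mat_pow N A n i k"
    using mat_pow_nonneg[of N A k n i] A k by force
  then have "0 < mat_pow N P n i k * P k j"
    using Suc.IH[OF k(1)] AP[OF k(1) Suc.prems(1)] A[OF k(1) Suc.prems(1)] k(3) by simp
  also have "\<dots> \<le> mat_pow N P (Suc n) i j"
    unfolding mat_pow.simps using k(1) P Suc.prems(1)
    by (intro member_le_sum[where f = "\<lambda>k. mat_pow N P n i k * P k j"] mult_nonneg_nonneg
      mat_pow_nonneg) auto
  finally show ?case .
qed simp

lemma irreducible_matrix_mono:
  assumes "irreducible_matrix N A"
    and "\<And>i j. i \<in> {1..N} \<Longrightarrow> j \<in> {1..N} \<Longrightarrow> 0 \<le> A i j"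
    and "\<And>i j. i \<in> {1..N} \<Longrightarrow> j \<in> {1..N} \<Longrightarrow> 0 \<le> P i j"
    and "\<And>i j. i \<in> {1..N} \<Longrightarrow> j \<in> {1..N} \<Longrightarrow> 0 < A i j \<Longrightarrow> 0 < P i j"
  shows "irreducible_matrix N P"
  using assms(1) mat_pow_pos_mono[of N A P, OF assms(2-4)] unfolding irreducible_matrix_def by blast

lemma irreducible_matrix_of_support:
  assumes "zero_one_matrix N A" and "irreducible_matrix N A" and "row_stochastic N P"
    and supp: "\<forall>i\<in>{1..N}. \<forall>j\<in>{1..N}. P i j > 0 \<longleftrightarrow> A i j = 1"
  shows "irreducible_matrix N P"
  using assms(2)
proof (rule irreducible_matrix_mono)
  fix i j assume ij: "i \<in> {1..N}" "j \<in> {1..N}"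
  have "A i j = 0 \<or> A i j = 1" "0 < P i j \<longleftrightarrow> A i j = 1"
    using assms(1) supp ij by (simp_all add: zero_one_matrix_def del: atLeastAtMost_iff)
  then show "0 \<le> A i j" "0 < A i j \<Longrightarrow> 0 < P i j"
    by auto
  show "0 \<le> P i j"
    using assms(3) ij by (simp add: row_stochastic_def del: atLeastAtMost_iff)
qed

lemma stationary_mat_pow:
  assumes p: "stationary_vector N P p" and j: "j \<in> {1..N}"
  shows "(\<Sum>i\<in>{1..N}. p i * mat_pow N P n i j) = p j"
  using j
proof (induction n arbitrary: j)
  case 0
  have "(\<Sum>i\<in>{1..N}. p i * mat_pow N P 0 i j) = (\<Sum>i\<in>{1..N}. if i = j then p i else 0)"
    by (intro sum.cong refl) simp
  then show ?case
    using 0 by simp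
next
  case (Suc n)
  have "(\<Sum>i\<in>{1..N}. p i * mat_pow N P (Suc n) i j)
      = (\<Sum>k\<in>{1..N}. (\<Sum>i\<in>{1..N}. p i * mat_pow N P n i k) * P k j)"
    unfolding mat_pow.simps sum_distrib_left sum_distrib_right
    by (subst sum.swap) (simp only: mult.assoc)
  also have "\<dots> = (\<Sum>k\<in>{1..N}. p k * P k j)"
    by (intro sum.cong refl) (simp only: Suc.IH)
  also have "\<dots> = p j"
    using p Suc.prems by (simp add: stationary_vector_def)
  finally show ?case .
qed

lemma stationary_vector_pos:
  assumes irr: "irreducible_matrix N P" and P: "\<And>i j. i \<in> {1..N} \<Longrightarrow> j \<in> {1..N} \<Longrightarrow> 0 \<le> P i j"
    and p: "stationary_vector N P p" and j: "j \<in> {1..N}"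
  shows "0 < p j"
proof -
  have p_nonneg: "0 \<le> p i" if "i \<in> {1..N}" for i
    using p that by (auto simp: stationary_vector_def)
  have "(\<Sum>i\<in>{1..N}. p i) \<noteq> 0"
    using p by (simp add: stationary_vector_def)
  then obtain i where i: "i \<in> {1..N}" "p i \<noteq> 0"
    by (rule sum.not_neutral_contains_not_neutral)
  obtain n where "0 < mat_pow N P n i j"
    using irr i(1) j unfolding irreducible_matrix_def by blast
  then have "0 < p i * mat_pow N P n i j"
    using i p_nonneg[OF i(1)] by simp
  also have "\<dots> \<le> (\<Sum>i\<in>{1..N}. p i * mat_pow N P n i j)"
    using i(1) p_nonneg j P
    by (intro member_le_sum[where f = "\<lambda>i. p i * mat_pow N P n i j"] mult_nonneg_nonneg
      mat_pow_nonneg) auto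
  also have "\<dots> = p j"
    by (rule stationary_mat_pow[OF p j])
  finally show ?thesis .
qed

section \<open>The escape rate\<close>

definition restrict_matrix :: "('a \<Rightarrow> 'a \<Rightarrow> real) \<Rightarrow> ('a \<Rightarrow> 'a \<Rightarrow> real) \<Rightarrow> 'a \<Rightarrow> 'a \<Rightarrow> real" where
  "restrict_matrix M B i j = (if B i j = 1 then M i j else 0)"

lemma path_weight_restrict_matrix:
  assumes "length w = Suc n"
  shows "path_weight (restrict_matrix M B) w
    = (if \<forall>i<n. B (w ! i) (w ! Suc i) = 1 then path_weight M w else 0)"
  using assms by (auto simp: path_weight_eq restrict_matrix_def)

lemma (in markov_prob) prob_edges:
  "prob {x \<in> space \<nu>. \<forall>i<n. B (x i) (x (Suc i)) = 1}
    = (\<Sum>w\<in>words {1..N} (Suc n). \<pi> (w ! 0) * path_weight (restrict_matrix K B) w)"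
proof -
  let ?D = "{w. \<forall>i<n. B (w ! i) (w ! Suc i) = 1}"
  have "prob {x \<in> space \<nu>. \<forall>i<n. B (x i) (x (Suc i)) = 1}
      = prob {x \<in> space \<nu>. prefix_word (Suc n) x \<in> ?D}"
    by simp
  also have "\<dots> = (\<Sum>w\<in>?D \<inter> words {1..N} (Suc n). point_mass \<nu> (prefix_word (Suc n)) w)"
    by (rule prob_prefix_event)
  also have "\<dots> = (\<Sum>w\<in>words {1..N} (Suc n) \<inter> ?D. \<pi> (w ! 0) * path_weight K w)"
    by (intro sum.cong Int_commute point_mass_prefix_word) blast
  also have "\<dots> = (\<Sum>w\<in>words {1..N} (Suc n). if w \<in> ?D then \<pi> (w ! 0) * path_weight K w else 0)"
    by (rule sum.inter_restrict) simp
  also have "\<dots> = (\<Sum>w\<in>words {1..N} (Suc n). \<pi> (w ! 0) * path_weight (restrict_matrix K B) w)"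
    by (intro sum.cong refl) (auto simp: path_weight_restrict_matrix[OF length_words])
  finally show ?thesis .
qed

lemma (in full_shift_prob) cylinder_eq:
  assumes "w \<in> words {1..N} n"
  shows "cylinder N A w = shift_space N A \<inter> (prefix_word n -` {w} \<inter> space \<nu>)"
  using prefix_word_eq_iff[OF length_words[OF assms]] length_words[OF assms]
  by (auto simp: cylinder_def space_nu shift_space_def)

lemma (in full_shift_prob) sets_cylinder: "w \<in> words {1..N} n \<Longrightarrow> cylinder N A w \<in> sets \<nu>"
  by (simp add: cylinder_eq sets_shift_space simple_functionD(2)[OF simple_function_prefix_word]
    sets.Int)

lemma markov_measure_imp_full_shift_prob: "markov_measure N A P p \<mu> \<Longrightarrow> full_shift_prob \<mu> N"
  by (simp add: markov_measure_def full_shift_prob_def full_shift_prob_axioms_def)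

lemma measure_cylinder_markov_measure:
  assumes \<mu>: "markov_measure N A P p \<mu>" and P: "row_stochastic N P" and p: "stationary_vector N P p"
    and w: "w \<in> words {1..N} (Suc n)"
  shows "measure \<mu> (cylinder N A w) = p (w ! 0) * path_weight P w"
proof -
  interpret nonneg_matrix "{1..N}" P
    using P by unfold_locales (auto simp: row_stochastic_def)
  have "w \<noteq> []" "set w \<subseteq> {1..N}"
    using w by (auto simp: words_def)
  then have "emeasure \<mu> (cylinder N A w) = ennreal (p (w ! 0) * path_weight P w)"
    using \<mu> unfolding markov_measure_def path_weight_def by blast
  moreover have "0 \<le> p (w ! 0) * path_weight P w"
    using p nth_words[OF w, of 0] path_weight_nonneg[OF w] by (simp add: stationary_vector_def)
  ultimately show ?thesis
    by (simp add: measure_def)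
qed

lemma AE_in_shift_space_markov_measure:
  assumes \<mu>: "markov_measure N A P p \<mu>" and P: "row_stochastic N P" and p: "stationary_vector N P p"
  shows "AE x in \<mu>. x \<in> shift_space N A"
proof -
  interpret full_shift_prob \<mu> N
    using \<mu> by (rule markov_measure_imp_full_shift_prob)
  have letters: "[a] \<in> words {1..N} (Suc 0)" if "a \<in> {1..N}" for a
    using that by (simp add: words_def)
  have "shift_space N A = (\<Union>a\<in>{1..N}. cylinder N A [a])"
    by (auto simp: cylinder_def shift_space_def)
  then have "prob (shift_space N A) = prob (\<Union>a\<in>{1..N}. cylinder N A [a])"
    by (rule arg_cong)
  also have "\<dots> = (\<Sum>a\<in>{1..N}. prob (cylinder N A [a]))"
    using sets_cylinder[OF letters]
    by (intro finite_measure_finite_Union) (auto simp: disjoint_family_on_def cylinder_def)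
  also have "\<dots> = (\<Sum>a\<in>{1..N}. p a)"
    using measure_cylinder_markov_measure[OF assms letters] by (intro sum.cong refl) simp
  also have "\<dots> = 1"
    using p by (simp add: stationary_vector_def)
  finally show ?thesis
    using prob_eq_1[OF sets_shift_space] by blast
qed

lemma markov_measure_imp_markov_prob:
  assumes \<mu>: "markov_measure N A P p \<mu>" and P: "row_stochastic N P" and p: "stationary_vector N P p"
  shows "markov_prob \<mu> N p P"
proof -
  interpret full_shift_prob \<mu> N
    using \<mu> by (rule markov_measure_imp_full_shift_prob)
  show ?thesis
  proof unfold_locales
    fix n w assume w: "w \<in> words {1..N} (Suc n)"
    have "AE x in \<mu>. x \<in> prefix_word (Suc n) -` {w} \<inter> space \<mu> \<longleftrightarrow> x \<in> cylinder N A w"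
      unfolding cylinder_eq[OF w] using AE_in_shift_space_markov_measure[OF assms]
      by eventually_elim blast
    then have "point_mass \<mu> (prefix_word (Suc n)) w = prob (cylinder N A w)"
      by (intro finite_measure_eq_AE sets_cylinder[OF w]
          simple_functionD(2)[OF simple_function_prefix_word])
    then show "point_mass \<mu> (prefix_word (Suc n)) w = p (w ! 0) * path_weight P w"
      by (simp only: measure_cylinder_markov_measure[OF assms w])
  qed
qed

lemma hole_matrix_allowed:
  assumes "hole_matrix N A G i j = 1"
  shows "A i j = 1"
proof -
  obtain x n where x: "x \<in> shift_space N A" "\<forall>k<2. x (n + k) = [i, j] ! k"
    using assms by (auto simp: hole_matrix_def allowed_word_def numeral_2_eq_2 split: if_splits)
  have "x n = i" "x (Suc n) = j"
    using x(2)[rule_format, of 0] x(2)[rule_format, of 1] by (auto simp: One_nat_def)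
  then show ?thesis
    using x(1) by (auto simp: shift_space_def)
qed

lemma shift_in_hole_iff:
  assumes G: "\<forall>w\<in>G. length w = 2" and x: "x \<in> shift_space N A"
  shows "(shift ^^ i) x \<in> hole N A G \<longleftrightarrow> hole_matrix N A G (x i) (x (Suc i)) \<noteq> 1"
proof -
  have "(shift ^^ i) x \<in> shift_space N A"
    using x by (auto simp: shift_space_def funpow_shift)
  moreover have "w = [w ! 0, w ! Suc 0]" if "w \<in> G" for w
    using G that by (auto simp: length_Suc_conv numeral_2_eq_2)
  ultimately have "(shift ^^ i) x \<in> cylinder N A w \<longleftrightarrow> w = [x i, x (Suc i)]" if "w \<in> G" for w
    using G that by (auto simp: cylinder_def funpow_shift less_Suc_eq numeral_2_eq_2)
  then have "(shift ^^ i) x \<in> hole N A G \<longleftrightarrow> [x i, x (Suc i)] \<in> G"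
    by (auto simp: hole_def)
  moreover have "allowed_word N A [x i, x (Suc i)]"
    unfolding allowed_word_def using x
    by (intro bexI[of _ x] exI[of _ i]) (auto simp: less_Suc_eq)
  ultimately show ?thesis
    by (simp add: hole_matrix_def)
qed

lemma (in markov_prob) prob_survivor:
  assumes A: "AE x in \<nu>. x \<in> shift_space N A" and G: "\<forall>w\<in>G. length w = 2"
  shows "prob (survivor N A G m)
    = (\<Sum>w\<in>words {1..N} (Suc (Suc m)).
        \<pi> (w ! 0) * path_weight (restrict_matrix K (hole_matrix N A G)) w)"
proof -
  let ?E = "{x \<in> space \<nu>. \<forall>i<Suc m. hole_matrix N A G (x i) (x (Suc i)) = 1}"
  have "?E = {x \<in> space \<nu>. prefix_word (Suc (Suc m)) x
      \<in> {w. \<forall>i<Suc m. hole_matrix N A G (w ! i) (w ! Suc i) = 1}}"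
    by simp
  then have "?E \<in> events"
    by (simp only: sets_prefix_event)
  moreover have survivor_eq: "survivor N A G m = shift_space N A \<inter> ?E"
    using shift_in_hole_iff[OF G, of _ N A]
    by (auto simp: survivor_def shift_space_def space_nu less_Suc_eq_le)
  moreover have "AE x in \<nu>. x \<in> shift_space N A \<inter> ?E \<longleftrightarrow> x \<in> ?E"
    using A by eventually_elim blast
  ultimately have "prob (survivor N A G m) = prob ?E"
    unfolding survivor_eq by (intro finite_measure_eq_AE sets.Int sets_shift_space)
  then show ?thesis
    by (simp only: prob_edges)
qed

lemma pressure_restrict_matrix:
  "pressure N (shift_space N B) (\<lambda>x. ln (restrict_matrix M B (x 0) (x 1)))
    = pressure N (shift_space N B) (\<lambda>x. ln (M (x 0) (x 1)))"
  by (intro pressure_cong borel_measurable_edge_function)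
    (auto simp: shift_space_def restrict_matrix_def One_nat_def)

lemma (in markov_prob) escape_rate:
  assumes A: "AE x in \<nu>. x \<in> shift_space N A" and G: "\<forall>w\<in>G. length w = 2"
    and N: "0 < N" and \<pi>_pos: "\<And>i. i \<in> {1..N} \<Longrightarrow> 0 < \<pi> i"
    and K_nonneg: "\<And>i j. i \<in> {1..N} \<Longrightarrow> j \<in> {1..N} \<Longrightarrow> 0 \<le> K i j"
    and K_pos: "\<And>i j. i \<in> {1..N} \<Longrightarrow> j \<in> {1..N} \<Longrightarrow> A i j = 1 \<Longrightarrow> 0 < K i j"
  shows "(\<lambda>m. escape_seq \<nu> (survivor N A G m) / ereal (real m))
    \<longlonglongrightarrow> - pressure N (shift_space N (hole_matrix N A G)) (\<lambda>x. ln (K (x 0) (x 1)))"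
proof -
  let ?H = "hole_matrix N A G"
  interpret holed: weighted_subshift N "restrict_matrix K ?H" ?H
    using K_nonneg K_pos hole_matrix_allowed by unfold_locales (auto simp: restrict_matrix_def)
  obtain c C where "0 < c" "\<And>m. c * holed.Z (Suc m) \<le> prob (survivor N A G m)"
    "0 < C" "\<And>m. prob (survivor N A G m) \<le> C * holed.Z (Suc m)"
    using holed.weighted_partition_function_bounds[of \<pi>] N \<pi>_pos prob_survivor[OF A G] by force
  then have "(\<lambda>m. extended_ln (prob (survivor N A G m)) / ereal (real m))
      \<longlonglongrightarrow> pressure N (shift_space N ?H) holed.potential"
    by (rule growth_rate_comparable)
      (intro holed.partition_function_nonneg growth_rate_Suc holed.variational_principle)+
  from tendsto_uminus_ereal[OF this] show ?thesis
    by (simp add: escape_seq_eq pressure_restrict_matrix)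
qed

theorem theorem3p6:
  fixes N :: nat and A P :: "nat \<Rightarrow> nat \<Rightarrow> real" and p :: "nat \<Rightarrow> real"
    and \<mu> :: "(nat \<Rightarrow> nat) measure" and G :: "nat list set"
  assumes A01: "zero_one_matrix N A"
    and A_irr: "irreducible_matrix N A"
    and P_stoch: "row_stochastic N P"
    and P_supp: "\<forall>i\<in>{1..N}. \<forall>j\<in>{1..N}. P i j > 0 \<longleftrightarrow> A i j = 1"
    and p_stat: "stationary_vector N P p"
    and mu: "markov_measure N A P p \<mu>"
    and G_fin: "finite G" and G_ne: "G \<noteq> {}"
    and G_words: "\<forall>w\<in>G. length w = 2 \<and> allowed_word N A w"
  shows "((\<lambda>m. escape_seq \<mu> (survivor N A G m) / ereal (real m)) \<longlongrightarrow>
           pressure N (shift_space N A) (\<lambda>x. ln (P (x 0) (x 1)))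
         - pressure N (shift_space N (hole_matrix N A G)) (\<lambda>x. ln (P (x 0) (x 1))))
         sequentially"
proof -
  have N: "0 < N"
    using p_stat by (cases N) (auto simp: stationary_vector_def)
  have P_nonneg: "0 \<le> P i j" if "i \<in> {1..N}" "j \<in> {1..N}" for i j
    using P_stoch that by (auto simp: row_stochastic_def)
  have P_irr: "irreducible_matrix N P"
    using A01 A_irr P_stoch P_supp by (rule irreducible_matrix_of_support)
  interpret full: weighted_subshift N P A
    using P_nonneg P_supp by unfold_locales auto
  interpret markov_prob \<mu> N p P
    using mu P_stoch p_stat by (rule markov_measure_imp_markov_prob)
  have "(\<lambda>m. escape_seq \<mu> (survivor N A G m) / ereal (real m))
      \<longlonglongrightarrow> - pressure N (shift_space N (hole_matrix N A G)) (\<lambda>x. ln (P (x 0) (x 1)))"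
    using G_words P_supp
    by (intro escape_rate AE_in_shift_space_markov_measure[OF mu P_stoch p_stat] N P_nonneg
        stationary_vector_pos[OF P_irr P_nonneg p_stat]) auto
  moreover have "pressure N (shift_space N A) (\<lambda>x. ln (P (x 0) (x 1))) = 0"
    using N P_stoch by (intro full.pressure_stochastic) (auto simp: row_stochastic_def)
  ultimately show ?thesis
    by simp
qed

end
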